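(* Fix integers $K,M,N\ge1$ and constants $P_c>0$, $P_{\max}>0$. Let $(\tilde{\mathbf{H}}(n))_{n\ge1}$ be a sequence of block-diagonal matrices $\tilde{\mathbf{H}}(n)=\operatorname{diag}(\tilde{\mathbf{H}}_1(n),\dots,\tilde{\mathbf{H}}_K(n))$, $\tilde{\mathbf{H}}_k(n)\in\mathbb{C}^{N\times M}$, with gradients satisfying $\|\mathbf{V}(n)\|\le V_0$ for all $n$ (notation as in the context). Let $\mathbf{X}(n)$ be generated by the noisy recursion $\mathbf{X}(n+1)=\boldsymbol{\Pi}(\mathbf{X}(n)+\gamma_n\hat{\mathbf{V}}(n))$ from an initial point $\mathbf{X}(1)\in\mathcal{X}$, where $\hat{\mathbf{V}}(n)$ are random Hermitian estimates of $\mathbf{V}(n)$ satisfying: (H1) unbiasedness: $\mathbb{E}[\hat{\mathbf{V}}(n)\mid\mathcal{F}_n]=\mathbf{V}(n)$, where $\mathcal{F}_n$ is the history of the process up to the choice of $\mathbf{X}(n)$; (H2) tame error tails: there exist $B>0$ and $\beta>2$ such that $\mathbb{P}(\|\hat{\mathbf{V}}(n)-\mathbf{V}(n)\|\ge z)\le B/z^\beta$ for all $z>0$ and all $n$. Suppose the step-sizes are $\gamma_n=\gamma/n^\alpha$ with $\gamma>0$ and $\alpha\in(2/\beta,1)$, and let $\mathbf{Q}(n)=\mathbf{Q}(\mathbf{X}(n))$. Then $\mathbf{Q}(n)$ leads to no regret almost surely, i.e. $\limsup_{T\to\infty}T^{-1}\mathrm{Reg}(T)\le0$ a.s., and $$\mathbb{E}[\mathrm{Reg}(T)]\le\frac{1}{\gamma_T}+\frac{\hat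 V_0^2}{2}\sum_{n=1}^T\gamma_n\quad\text{for all }T\ge1,$$ where $\hat V_0^2=\sup_n\mathbb{E}[\|\hat{\mathbf{V}}(n)\|^2]$.
   Context: All matrices are complex; $\mathbf{A}^\dagger$ is the conjugate transpose and $\|\mathbf{A}\|=\operatorname{tr}(\mathbf{A}^\dagger\mathbf{A})^{1/2}$ the Frobenius norm. The effective channel matrices $\tilde{\mathbf{H}}(n)$ are assumed uniformly bounded in $n$. $\mathcal{Q}=\{\mathbf{Q}=\operatorname{diag}(\mathbf{Q}_1,\dots,\mathbf{Q}_K):\mathbf{Q}_k\in\mathbb{C}^{M\times M}\text{ Hermitian},\ \mathbf{Q}_k\succeq0,\ \sum_k\operatorname{tr}\mathbf{Q}_k\le P_{\max}\}$. $\mathrm{EE}(\mathbf{Q};n)=\dfrac{\log\det(\mathbf{I}+\tilde{\mathbf{H}}(n)\mathbf{Q}\tilde{\mathbf{H}}(n)^\dagger)}{P_c+\operatorname{tr}\mathbf{Q}}$, $R_n(\mathbf{Q})=\log\det(\mathbf{I}+\tilde{\mathbf{H}}(n)\mathbf{Q}\tilde{\mathbf{H}}(n)^\dagger)$. $\mathcal{X}=\{\mathbf{X}=\operatorname{diag}(\mathbf{X}_1,\dots,\mathbf{X}_K):\mathbf{X}_k\text{ Hermitian } M\times M,\ \mathbf{X}_k\succeq0,\ \sum_k\operatorname{tr}\mathbf{X}_k\le1\}$, $\mathbf{Q}(\mathbf{X})=\dfrac{P_cP_{\max}}{P_c+P_{\max}(1-\operatorname{tr}\mathbf{X})}\mathbf{X}$,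 $u(\mathbf{X};n)=\mathrm{EE}(\mathbf{Q}(\mathbf{X});n)$. True gradient: $\mathbf{V}(n)=\nabla_{\mathbf{X}}u(\mathbf{X}(n);n)=\dfrac{P_{\max}}{P_c+P_{\max}}\Big[\mathbf{A}_n+\dfrac{\operatorname{tr}(\mathbf{A}_n\mathbf{Q}(n))-R_n(\mathbf{Q}(n))}{P_c}\mathbf{I}\Big]$ with $\mathbf{A}_n=\tilde{\mathbf{H}}(n)^\dagger[\mathbf{I}+\tilde{\mathbf{H}}(n)\mathbf{Q}(n)\tilde{\mathbf{H}}(n)^\dagger]^{-1}\tilde{\mathbf{H}}(n)$. $\boldsymbol{\Pi}(\mathbf{Y})=\arg\min_{\mathbf{X}\in\mathcal{X}}\|\mathbf{X}-\mathbf{Y}\|^2$. $\mathrm{Reg}(T)=\max_{\mathbf{Q}\in\mathcal{Q}}\sum_{n=1}^T[\mathrm{EE}(\mathbf{Q};n)-\mathrm{EE}(\mathbf{Q}(n);n)]$. *)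

theory Defs
  imports "HOL-Analysis.Analysis" "HOL-Probability.Probability"
begin

text \<open>Complex matrices are rendered as type-indexed matrices.  Index type 'k enumerates
  the K users, 'm the M transmit antennas, 'n the N receive antennas.  A block-diagonal
  KM x KM matrix is a matrix indexed by 'k \<times> 'm whose off-diagonal blocks vanish.
  The norm on complex^'c^'r is the Frobenius norm.\<close>

definition adjc :: "complex^'c^'r \<Rightarrow> complex^'r^'c" where
  "adjc A = (\<chi> i j. cnj (A $ j $ i))"

definition hermitian :: "complex^'r^'r \<Rightarrow> bool" where
  "hermitian A \<longleftrightarrow> adjc A = A"

definition psd :: "complex^'r^'r \<Rightarrow> bool" where
  "psd A \<longleftrightarrow> hermitian A \<and>
     (\<forall>x::complex^'r. 0 \<le> Re (\<Sum>i\<in>UNIV. \<Sum>j\<in>UNIV. cnj (x $ i) * A $ i $ j * x $ j))"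

definition block_diag :: "complex^('k::finite \<times> 'c::finite)^('k \<times> 'r::finite) \<Rightarrow> bool" where
  "block_diag A \<longleftrightarrow> (\<forall>k k' i j. k \<noteq> k' \<longrightarrow> A $ (k, i) $ (k', j) = 0)"

text \<open>The feasible set \<Q> (sum of block traces = trace of Q).\<close>
definition QSet :: "real \<Rightarrow> (complex^('k::finite \<times> 'm::finite)^('k \<times> 'm)) set" where
  "QSet Pmax = {Q. block_diag Q \<and> psd Q \<and> Re (trace Q) \<le> Pmax}"

definition XSet :: "(complex^('k::finite \<times> 'm::finite)^('k \<times> 'm)) set" where
  "XSet = {X. block_diag X \<and> psd X \<and> Re (trace X) \<le> 1}"

text \<open>R_n(Q) = log det (I + H Q H^dagger) (natural logarithm; the determinant is real).\<close>
definition rate :: "complex^('k::finite \<times> 'm::finite)^('k \<times> 'n::finite) \<Rightarrow> complex^('k \<times> 'm)^('k \<times> 'm) \<Rightarrow> real" where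
  "rate H Q = ln (Re (det (mat 1 + H ** Q ** adjc H)))"

definition EE :: "real \<Rightarrow> complex^('k::finite \<times> 'm::finite)^('k \<times> 'n::finite) \<Rightarrow> complex^('k \<times> 'm)^('k \<times> 'm) \<Rightarrow> real" where
  "EE Pc H Q = rate H Q / (Pc + Re (trace Q))"

definition Qmap :: "real \<Rightarrow> real \<Rightarrow> complex^('k::finite \<times> 'm::finite)^('k \<times> 'm) \<Rightarrow> complex^('k \<times> 'm)^('k \<times> 'm)" where
  "Qmap Pc Pmax X = (Pc * Pmax / (Pc + Pmax * (1 - Re (trace X)))) *\<^sub>R X"

definition gradV :: "real \<Rightarrow> real \<Rightarrow> complex^('k::finite \<times> 'm::finite)^('k \<times> 'n::finite) \<Rightarrow> complex^('k \<times> 'm)^('k \<times> 'm)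
    \<Rightarrow> complex^('k \<times> 'm)^('k \<times> 'm)" where
  "gradV Pc Pmax H X =
     (let Q = Qmap Pc Pmax X;
          A = adjc H ** matrix_inv (mat 1 + H ** Q ** adjc H) ** H
      in (Pmax / (Pc + Pmax)) *\<^sub>R (A + ((Re (trace (A ** Q)) - rate H Q) / Pc) *\<^sub>R mat 1))"

definition proj :: "complex^('k::finite \<times> 'm::finite)^('k \<times> 'm) \<Rightarrow> complex^('k \<times> 'm)^('k \<times> 'm)" where
  "proj Y = (SOME X. X \<in> XSet \<and> (\<forall>X'\<in>XSet. norm (X - Y) \<le> norm (X' - Y)))"

definition regret :: "real \<Rightarrow> real \<Rightarrow> (nat \<Rightarrow> complex^('k::finite \<times> 'm::finite)^('k \<times> 'n::finite))
    \<Rightarrow> (nat \<Rightarrow> complex^('k \<times> 'm)^('k \<times> 'm)) \<Rightarrow> nat \<Rightarrow> real" where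
  "regret Pc Pmax H Qs T =
     (SUP Q\<in>QSet Pmax. \<Sum>n = 1..T. EE Pc (H n) Q - EE Pc (H n) (Qs n))"

end

theory Submission
  imports Defs "HOL-Library.Discrete_Functions" "HOL-Real_Asymp.Real_Asymp"
begin

text \<open>
  In the variable \<open>X\<close> the energy efficiency is, up to a factor, the perspective of the concave
  function \<open>log det (I + H Q H\<^sup>\<dagger>)\<close>, hence concave with supergradient \<open>V(n)\<close>.  So the regret is at most
  the sum of \<open>\<langle>V(n), X - X(n)\<rangle>\<close>, which splits into the linear regret of projected gradient
  steps along the estimates and a martingale noise term.  The former is handled by the usual
  telescoping estimate with \<open>\<parallel>X - Y\<parallel>\<^sup>2 \<le> 2\<close> on the feasible set.  The noise has mean zero; its
  tail bound gives uniformly bounded second moments, so its averages vanish almost surely by the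
  strong law for orthogonal variables.  Since the noise is paired with \<open>X\<close> only through its sum, this
  holds uniformly in \<open>X\<close>.
\<close>

section \<open>Positive semidefinite matrices\<close>

text \<open>As a ratio, \<open>EE\<close> is in general not concave in \<open>Q\<close>, so no
  supergradient inequality is available there. \<open>Qmap\<close> is a Charnes-Cooper substitution:
  it turns division by the denominator into multiplication by an affine scale. The matrix
  inequalities avoid eigenvalues: symmetric elimination has determinant one and never raises a
  diagonal entry, which gives at once real determinants, nonnegative traces of products and
  Hadamard's inequality. The exponents enter separately: \<beta> > 2 gives second moments, \<alpha>
  > 0 makes the weighted squares \<gamma>_n times \<open>(norm (Vh n \<omega>))\<^sup>2\<close>
  average to zero, and \<alpha> < 1 makes 1/\<gamma>_T sublinear. The diameter constant 2 is what
  gives 1/\<gamma>_T the coefficient one. The channels do not depend on \<omega>, so the best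
  comparator value is a deterministic number. The mean bound is therefore proved for one fixed
  comparator, where the noise integrates to zero, and the supremum is taken only afterwards.\<close>

definition cinner :: "complex^'n \<Rightarrow> complex^'n \<Rightarrow> complex" where
  "cinner x y = (\<Sum>i\<in>UNIV. cnj (x $ i) * y $ i)"

lemma adjc_nth [simp]: "adjc A $ i $ j = cnj (A $ j $ i)"
  by (simp add: adjc_def)

lemma adjc_adjc [simp]: "adjc (adjc A) = A"
  by (simp add: vec_eq_iff)

lemma adjc_add: "adjc (A + B) = adjc A + adjc B"
  by (simp add: vec_eq_iff)

lemma adjc_scaleR: "adjc (c *\<^sub>R A) = c *\<^sub>R adjc A"
  by (simp add: vec_eq_iff)

lemma adjc_mat_1 [simp]: "adjc (mat 1) = mat 1"
  by (simp add: vec_eq_iff mat_def)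

lemma adjc_mult: "adjc (A ** B) = adjc B ** adjc A"
  by (simp add: vec_eq_iff matrix_matrix_mult_def mult.commute)

lemma det_adjc: "det (adjc A) = cnj (det A)"
proof -
  have "det (adjc A) = det (\<chi> i j. cnj (transpose A $ i $ j))"
    by (simp add: adjc_def transpose_def)
  also have "\<dots> = cnj (det (transpose A))"
    by (simp add: det_def)
  finally show ?thesis by simp
qed

lemma cinner_adjc: "cinner x (A *v y) = cinner (adjc A *v x) y"
proof -
  have "cinner x (A *v y) = (\<Sum>i\<in>UNIV. \<Sum>j\<in>UNIV. cnj (x $ i) * (A $ i $ j * y $ j))"
    by (simp add: cinner_def matrix_vector_mult_def sum_distrib_left)
  also have "\<dots> = (\<Sum>j\<in>UNIV. \<Sum>i\<in>UNIV. cnj (x $ i) * (A $ i $ j * y $ j))"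
    by (rule sum.swap)
  finally show ?thesis
    by (simp add: cinner_def matrix_vector_mult_def sum_distrib_right sum_distrib_left mult_ac)
qed

lemma psd_iff_cinner: "psd A \<longleftrightarrow> hermitian A \<and> (\<forall>x. 0 \<le> Re (cinner x (A *v x)))"
  by (simp add: psd_def cinner_def matrix_vector_mult_def sum_distrib_left mult.assoc)

lemma psd_congruence:
  assumes "psd A"
  shows "psd (L ** A ** adjc L)"
proof -
  have "cinner x ((L ** A ** adjc L) *v x) = cinner (adjc L *v x) (A *v (adjc L *v x))" for x
    by (simp add: cinner_adjc[of x L] flip: matrix_vector_mul_assoc)
  moreover have "adjc (L ** A ** adjc L) = L ** adjc A ** adjc L"
    by (simp add: adjc_mult matrix_mul_assoc)
  ultimately show ?thesis
    using assms by (simp add: psd_iff_cinner hermitian_def)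
qed

lemma psd_add:
  assumes "psd A" "psd B"
  shows "psd (A + B)"
proof -
  have "cinner x ((A + B) *v x) = cinner x (A *v x) + cinner x (B *v x)" for x
    by (simp add: cinner_def matrix_vector_mult_add_rdistrib distrib_left sum.distrib)
  then show ?thesis
    using assms by (simp add: psd_iff_cinner hermitian_def adjc_add)
qed

lemma psd_scaleR:
  assumes "psd A" "0 \<le> c"
  shows "psd (c *\<^sub>R A)"
proof -
  have "cinner x ((c *\<^sub>R A) *v x) = c *\<^sub>R cinner x (A *v x)" for x
    by (simp add: cinner_def matrix_vector_mult_def flip: scaleR_sum_right)
  then show ?thesis
    using assms by (simp add: psd_iff_cinner hermitian_def adjc_scaleR)
qed

lemma Re_cinner_self: "Re (cinner x x) = (norm x)\<^sup>2"
  by (simp add: cinner_def norm_vec_def L2_set_def sum_nonneg cmod_power2 flip: power2_eq_square)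

lemma psd_mat_1: "psd (mat 1)"
  by (simp add: psd_iff_cinner hermitian_def Re_cinner_self)

lemma hermitian_nth: "hermitian A \<Longrightarrow> A $ j $ i = cnj (A $ i $ j)"
  unfolding hermitian_def by (metis adjc_nth)

lemma hermitian_diag: "hermitian A \<Longrightarrow> A $ i $ i = of_real (Re (A $ i $ i))"
  by (metis complex_is_Real_iff hermitian_nth Reals_cnj_iff of_real_Re)

lemma psd_hermitian: "psd A \<Longrightarrow> hermitian A"
  by (simp add: psd_def)

lemma cinner_axis_mult:
  assumes "i \<noteq> j"
  shows "cinner (axis i a + axis j b) (A *v (axis i a + axis j b)) =
    cnj a * A$i$i * a + cnj a * A$i$j * b + cnj b * A$j$i * a + cnj b * A$j$j * b"
proof -
  have 1: "cinner (axis i a) y = cnj a * y $ i" for i a and y :: "complex^'n"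
    by (simp add: cinner_def axis_def if_distrib[of cnj] if_distrib[of "\<lambda>x. x * _"] cong: if_cong)
  have 2: "(A *v axis i a) $ k = A $ k $ i * a" for i a k
    by (simp add: matrix_vector_mult_def axis_def if_distrib[of "\<lambda>x. _ * x"] cong: if_cong)
  have 3: "cinner (u + v) y = cinner u y + cinner v y" for u v y :: "complex^'n"
    by (simp add: cinner_def algebra_simps sum.distrib)
  show ?thesis
    by (simp add: 3 1 2 matrix_vector_right_distrib algebra_simps)
qed

lemma psd_diag_nonneg: "psd A \<Longrightarrow> 0 \<le> Re (A $ i $ i)"
proof -
  assume A: "psd A"
  have "cinner (axis i 1) (A *v axis i 1) = A $ i $ i"
    by (simp add: cinner_def matrix_vector_mult_def axis_def if_distrib[of "\<lambda>x. x * _"]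
       if_distrib[of "\<lambda>x. _ * x"] if_distrib[of cnj] cong: if_cong)
  with A show ?thesis unfolding psd_iff_cinner by metis
qed

text \<open>Nonnegativity of a principal 2x2 minor, read off from the quadratic form on vectors
  supported on \<open>i\<close> and \<open>j\<close>.\<close>

lemma psd_offdiag_le:
  assumes A: "psd A"
  shows "(cmod (A $ i $ j))\<^sup>2 \<le> Re (A $ i $ i) * Re (A $ j $ j)"
proof (cases "i = j")
  case True
  then show ?thesis
    using hermitian_diag[OF psd_hermitian[OF A], of i] psd_diag_nonneg[OF A, of i]
    by (metis cmod_eq_Re complex_is_Real_iff Reals_of_real order_refl power2_abs power2_eq_square)
next
  case False
  define c p q where "c = A $ i $ j" and "p = Re (A $ i $ i)" and "q = Re (A $ j $ j)"
  have Aji: "A $ j $ i = cnj c" using hermitian_nth[OF psd_hermitian[OF A]] c_def by metis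
  have Aii: "A $ i $ i = of_real p" and Ajj: "A $ j $ j = of_real q"
    using hermitian_diag[OF psd_hermitian[OF A]] p_def q_def by metis+
  have q0: "q \<ge> 0" using psd_diag_nonneg[OF A] q_def by simp
  have p0: "p \<ge> 0" using psd_diag_nonneg[OF A] p_def by simp
  \<comment> \<open>The factor \<open>cnj c\<close> in the test vector cancels the phase of the
    off-diagonal entry, leaving a real quadratic form in \<open>s\<close> and
    \<open>t\<close>.\<close>
  have main: "0 \<le> p * t\<^sup>2 - 2 * t * s * (cmod c)\<^sup>2 + s\<^sup>2 * q * (cmod c)\<^sup>2" for s t :: real
  proof -
    have "0 \<le> Re (cinner (axis i (of_real t) + axis j (- of_real s * cnj c)) (A *v (axis i (of_real t) + axis j (- of_real s * cnj c))))"
      using A unfolding psd_iff_cinner by blast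
    also have "\<dots> = p * t\<^sup>2 - 2 * t * s * (cmod c)\<^sup>2 + s\<^sup>2 * q * (cmod c)\<^sup>2"
      unfolding cinner_axis_mult[OF False] Aji Aii Ajj c_def[symmetric]
      unfolding cmod_power2 by (simp add: power2_eq_square algebra_simps)
    finally show ?thesis .
  qed
  show ?thesis
  proof (cases "q = 0")
    case True
    \<comment> \<open>For \<open>q = 0\<close> the form is affine in \<open>s\<close>;
      \<open>t = (cmod c)\<^sup>2\<close> and \<open>s = p + 1\<close> make it negative unless
      \<open>c = 0\<close>.\<close>
    have "0 \<le> - (p + 2) * ((cmod c)\<^sup>2 * (cmod c)\<^sup>2)"
      using main[of "(cmod c)\<^sup>2" "p + 1"] True by (simp add: algebra_simps power2_eq_square)
    moreover have "0 < (p + 2) * ((cmod c)\<^sup>2 * (cmod c)\<^sup>2)" if "c \<noteq> 0"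
      using that p0 by simp
    ultimately have "c = 0" by (metis minus_mult_left neg_0_le_iff_le not_less)
    then show ?thesis using p0 q0 by (simp add: c_def p_def q_def)
  next
    case False
    then have "0 \<le> q * (p * q - (cmod c)\<^sup>2)"
      using main[of q 1] by (simp add: algebra_simps power2_eq_square)
    then have "(cmod c)\<^sup>2 \<le> p * q" using False q0 by (simp add: zero_le_mult_iff)
    then show ?thesis by (simp add: c_def p_def q_def)
  qed
qed

text \<open>Symmetric Gaussian elimination with pivot \<open>M $ i $ i\<close>; a vanishing pivot forces its row to vanish.\<close>

lemma psd_eliminate_index:
  fixes M :: "complex^'n^'n"
  assumes M: "psd M" and clear: "\<And>j k. j \<in> S \<Longrightarrow> k \<noteq> j \<Longrightarrow> M $ j $ k = 0"
  obtains L where "det L = 1"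
    "\<And>j k. j \<in> insert i S \<Longrightarrow> k \<noteq> j \<Longrightarrow> (L ** M ** adjc L) $ j $ k = 0"
    "\<And>j. Re ((L ** M ** adjc L) $ j $ j) \<le> Re (M $ j $ j)"
proof (cases "M $ i $ i = 0")
  case True
  have "M $ i $ k = 0" for k using psd_offdiag_le[OF M, of i k] True by simp
  then show ?thesis using clear by (intro that[of "mat 1"]) auto
next
  case False
  define a where "a = M $ i $ i"
  have a: "a = of_real (Re a)" "a \<noteq> 0"
    using hermitian_diag[OF psd_hermitian[OF M]] False by (simp_all add: a_def)
  have a0: "Re a > 0"
    using a psd_diag_nonneg[OF M, of i] unfolding a_def by (metis less_eq_real_def of_real_0)
  \<comment> \<open>\<open>L\<close> below subtracts \<open>u j\<close> times row \<open>i\<close>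
    from row \<open>j\<close>; \<open>u i = 0\<close> keeps the pivot row.\<close>
  define u where "u = (\<lambda>j. if j = i then 0 else M $ j $ i / a)"
  define L :: "complex^'n^'n" where "L = (\<chi> j k. (if j = k then 1 else 0) - (if k = i then u j else 0))"
  have ca: "cnj a = a" using a(1) by (metis complex_cnj_complex_of_real)
  have LM: "(L ** M) $ j $ k = M $ j $ k - u j * M $ i $ k" for j k
    by (simp add: L_def matrix_matrix_mult_def algebra_simps sum_subtractf if_distrib[of "\<lambda>x. x * _"]
       if_distrib[of "\<lambda>x. _ * x"] cong: if_cong)
  have N: "(L ** M ** adjc L) $ j $ k = M $ j $ k - u j * M $ i $ k - (M $ j $ i - u j * a) * cnj (u k)" for j k
  proof -
    have "(L ** M ** adjc L) $ j $ k = (L ** M) $ j $ k - (L ** M) $ j $ i * cnj (u k)"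
      by (subst matrix_matrix_mult_def)
        (simp add: L_def algebra_simps sum_subtractf if_distrib[of "\<lambda>x. x * _"] if_distrib[of cnj]
         if_distrib[of "\<lambda>x. _ * x"] cong: if_cong)
    then show ?thesis by (simp add: LM a_def)
  qed
  have N1: "(L ** M ** adjc L) $ j $ k = M $ j $ k - u j * M $ i $ k" if "j \<noteq> i" for j k
    using that a by (simp add: N u_def)
  have cu: "a * cnj (u k) = (if k = i then 0 else M $ i $ k)" for k
    using a ca hermitian_nth[OF psd_hermitian[OF M], of i k] by (simp add: u_def)
  have N2: "(L ** M ** adjc L) $ i $ k = (if k = i then a else 0)" for k
    using cu[of k] by (simp add: N u_def a_def)
  \<comment> \<open>\<open>L\<close> differs from the identity only in column \<open>i\<close>.
    Transposed, this is a row operation: a combination of the other unit rows is added to row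
    \<open>i\<close>.\<close>
  have "det L = det (transpose L)" by simp
  also have "transpose L = (\<chi> k. if k = i then row i (mat 1) + (\<chi> j. - u j) else row k (mat 1))"
    by (auto simp: vec_eq_iff transpose_def L_def row_def mat_def)
  also have "det \<dots> = det (mat 1 :: complex^'n^'n)"
  proof (rule det_row_span)
    have "(\<chi> j. - u j) = (\<Sum>j\<in>UNIV - {i}. (- u j) *s row j (mat 1 :: complex^'n^'n))"
      by (auto simp: vec_eq_iff row_def mat_def u_def if_distrib[of "\<lambda>x. _ * x"] sum_negf sum.delta cong: if_cong)
    also have "\<dots> \<in> vec.span {row j (mat 1 :: complex^'n^'n) |j. j \<noteq> i}"
      by (intro vec.span_sum vec.span_scale vec.span_base) auto
    finally show "(\<chi> j. - u j) \<in> vec.span {row j (mat 1 :: complex^'n^'n) |j. j \<noteq> i}" .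
  qed
  finally have "det L = 1" by simp
  moreover have "(L ** M ** adjc L) $ j $ k = 0" if "j \<in> insert i S" "k \<noteq> j" for j k
  proof (cases "j = i")
    case True with N2 that show ?thesis by simp
  next
    case False
    with that have "j \<in> S" by simp
    \<comment> \<open>A row cleared earlier has a zero in column \<open>i\<close>, so its multiplier
      vanishes and it stays cleared.\<close>
    then have "M $ j $ k = 0" "u j = 0" using clear that False by (auto simp: u_def)
    then show ?thesis using N1[OF False] by simp
  qed
  moreover have "Re ((L ** M ** adjc L) $ j $ j) \<le> Re (M $ j $ j)" for j
  proof (cases "j = i")
    case True then show ?thesis by (simp add: N2 a_def)
  next
    case False
    \<comment> \<open>The amount by which a diagonal entry drops is a squared modulus over the
      positive pivot.\<close>
    have "u j * M $ i $ j = M $ j $ i * cnj (M $ j $ i) / a"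
      using False hermitian_nth[OF psd_hermitian[OF M], of j i] by (simp add: u_def)
    also have "\<dots> = of_real ((cmod (M $ j $ i))\<^sup>2 / Re a)"
      by (subst a(1)) (simp add: complex_norm_square[symmetric])
    finally show ?thesis using False a0 by (simp add: N1)
  qed
  ultimately show ?thesis using that by blast
qed

text \<open>Elimination index by index stands in for the spectral theorem. As
  \<open>det L = 1\<close>, the product of the \<open>d i\<close> is \<open>det M\<close>, so the
  last clause is Hadamard's inequality entry by entry.\<close>

lemma psd_congruent_diagonal:
  fixes M :: "complex^'n^'n"
  assumes "psd M"
  obtains L d where "det L = 1" "L ** M ** adjc L = (\<chi> i j. if i = j then of_real (d i) else 0)"
    "\<And>i. 0 \<le> d i" "\<And>i. d i \<le> Re (M $ i $ i)"
proof -
  have "\<exists>L. det L = 1 \<and> (\<forall>j\<in>S. \<forall>k. k \<noteq> j \<longrightarrow> (L ** M ** adjc L) $ j $ k = 0) \<and>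
      (\<forall>j. Re ((L ** M ** adjc L) $ j $ j) \<le> Re (M $ j $ j))" if "finite S" for S
    using that
  proof (induction S rule: finite_induct)
    case empty
    then show ?case by (intro exI[of _ "mat 1"]) simp
  next
    case (insert i S)
    then obtain L where L: "det L = 1" "\<forall>j\<in>S. \<forall>k. k \<noteq> j \<longrightarrow> (L ** M ** adjc L) $ j $ k = 0"
      "\<forall>j. Re ((L ** M ** adjc L) $ j $ j) \<le> Re (M $ j $ j)" by blast
    obtain L' where L': "det L' = 1"
      "\<And>j k. j \<in> insert i S \<Longrightarrow> k \<noteq> j \<Longrightarrow> (L' ** (L ** M ** adjc L) ** adjc L') $ j $ k = 0"
      "\<And>j. Re ((L' ** (L ** M ** adjc L) ** adjc L') $ j $ j) \<le> Re ((L ** M ** adjc L) $ j $ j)"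
      using psd_eliminate_index[OF psd_congruence[OF assms, of L], of S i] L(2) by metis
    have "L' ** (L ** M ** adjc L) ** adjc L' = (L' ** L) ** M ** adjc (L' ** L)"
      by (simp add: adjc_mult matrix_mul_assoc)
    then show ?case using L L' by (intro exI[of _ "L' ** L"]) (fastforce simp: det_mul intro: order_trans)
  qed
  from this[of UNIV] obtain L where L: "det L = 1" "\<forall>j k. k \<noteq> j \<longrightarrow> (L ** M ** adjc L) $ j $ k = 0"
      "\<forall>j. Re ((L ** M ** adjc L) $ j $ j) \<le> Re (M $ j $ j)" by auto
  show ?thesis
  proof (rule that[of L "\<lambda>i. Re ((L ** M ** adjc L) $ i $ i)"])
    show "L ** M ** adjc L = (\<chi> i j. if i = j then of_real (Re ((L ** M ** adjc L) $ i $ i)) else 0)"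
      using L(2) hermitian_diag[OF psd_hermitian[OF psd_congruence[OF assms, of L]]]
      by (auto simp: vec_eq_iff)
  qed (use L psd_diag_nonneg[OF psd_congruence[OF assms, of L]] in auto)
qed

lemma det_of_real_diagonal: "det (\<chi> i j. if i = j then of_real (d i) else (0::complex)) = of_real (\<Prod>i\<in>UNIV. d i)"
  by (subst det_diagonal) auto

lemma psd_det_real:
  assumes "psd M"
  shows "0 \<le> Re (det M)" "det M = of_real (Re (det M))"
proof -
  obtain L d where L: "det L = 1" "L ** M ** adjc L = (\<chi> i j. if i = j then of_real (d i) else 0)"
    "\<And>i. 0 \<le> d i" "\<And>i. d i \<le> Re (M $ i $ i)" by (rule psd_congruent_diagonal[OF assms]) (rule that)
  have "det M = det (L ** M ** adjc L)" by (simp add: det_mul det_adjc L(1))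
  also have "\<dots> = of_real (\<Prod>i\<in>UNIV. d i)" by (simp add: L(2) det_of_real_diagonal)
  finally show "0 \<le> Re (det M)" "det M = of_real (Re (det M))"
    using L(3) by (auto intro: prod_nonneg simp del: of_real_prod)
qed

section \<open>Inverses, traces and the Frobenius inner product\<close>

lemma matrix_mult_diff_right: "A ** (B - C) = A ** B - A ** (C :: 'a::ring_1^'n^'m)"
  by (simp add: vec_eq_iff matrix_matrix_mult_def algebra_simps sum_subtractf)

lemma matrix_mult_diff_left: "(A - B) ** C = A ** C - B ** (C :: 'a::ring_1^'n^'m)"
  by (simp add: vec_eq_iff matrix_matrix_mult_def algebra_simps sum_subtractf)

lemma inner_eq_trace: "hermitian B \<Longrightarrow> inner A B = Re (trace (A ** B))"
proof -
  assume B: "hermitian B"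
  have "inner A B = (\<Sum>i\<in>UNIV. \<Sum>j\<in>UNIV. Re (A $ i $ j * cnj (B $ i $ j)))"
    by (simp add: inner_vec_def inner_complex_def)
  then show ?thesis
    by (simp add: trace_def matrix_matrix_mult_def hermitian_nth[OF B, symmetric])
qed

lemma matrix_inv_inverse:
  fixes A :: "complex^'n^'n"
  assumes "det A \<noteq> 0"
  shows "matrix_inv A ** A = mat 1" "A ** matrix_inv A = mat 1"
proof -
  have "\<exists>A'. A ** A' = mat 1 \<and> A' ** A = mat 1"
    using assms by (simp add: invertible_det_nz[symmetric] invertible_def)
  from someI_ex[OF this] show "matrix_inv A ** A = mat 1" "A ** matrix_inv A = mat 1"
    unfolding matrix_inv_def by auto
qed

lemma matrix_inv_unique:
  fixes A :: "complex^'n^'n"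
  assumes "B ** A = mat 1"
  shows "matrix_inv A = B"
proof -
  have "det B * det A = 1" using assms by (metis det_I det_mul)
  then have "det A \<noteq> 0" by auto
  then show ?thesis
    by (metis assms matrix_inv_inverse(2) matrix_mul_assoc matrix_mul_lid matrix_mul_rid)
qed

text \<open>With \<open>B = K ** D ** adjc K\<close> and \<open>D\<close> diagonal, cyclicity of the
  trace leaves the diagonal entries of the psd matrix \<open>adjc K ** A ** K\<close> weighted by
  \<open>d i\<close>.\<close>

lemma inner_psd_nonneg:
  fixes A B :: "complex^'n^'n"
  assumes A: "psd A" and B: "psd B"
  shows "0 \<le> inner A B"
proof -
  obtain L d where L: "det L = 1" "L ** B ** adjc L = (\<chi> i j. if i = j then of_real (d i) else 0)"
    "\<And>i. 0 \<le> d i" "\<And>i. d i \<le> Re (B $ i $ i)" by (rule psd_congruent_diagonal[OF B]) (rule that)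
  define K where "K = matrix_inv L"
  have K: "K ** L = mat 1" using L(1) matrix_inv_inverse[of L] by (simp add: K_def)
  have K': "adjc L ** adjc K = mat 1" using arg_cong[OF K, of adjc] by (simp add: adjc_mult)
  define D where "D = L ** B ** adjc L"
  have "K ** D ** adjc K = (K ** L) ** B ** (adjc L ** adjc K)"
    by (simp add: D_def matrix_mul_assoc)
  then have BD: "B = K ** D ** adjc K" by (simp add: K K')
  have "inner A B = Re (trace (A ** (K ** D ** adjc K)))"
    using inner_eq_trace[OF psd_hermitian[OF B]] BD by simp
  also have "trace (A ** (K ** D ** adjc K)) = trace ((A ** K ** D) ** adjc K)"
    by (simp add: matrix_mul_assoc)
  also have "\<dots> = trace (adjc K ** (A ** K ** D))" by (rule trace_mul_sym)
  also have "\<dots> = trace ((adjc K ** A ** adjc (adjc K)) ** D)" by (simp add: matrix_mul_assoc)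
  also have "\<dots> = (\<Sum>i\<in>UNIV. (adjc K ** A ** adjc (adjc K)) $ i $ i * of_real (d i))"
    unfolding trace_def D_def L(2)
    by (subst matrix_matrix_mult_def) (simp add: if_distrib[of "\<lambda>x. _ * x"] cong: if_cong)
  also have "Re \<dots> = (\<Sum>i\<in>UNIV. Re ((adjc K ** A ** adjc (adjc K)) $ i $ i) * d i)"
    by (simp add: cong: sum.cong)
  also have "\<dots> \<ge> 0"
    by (intro sum_nonneg mult_nonneg_nonneg L(3) psd_diag_nonneg psd_congruence A)
  finally show ?thesis .
qed

text \<open>The 2x2 minor bounds sum to the square of the trace. This places \<open>XSet\<close>
  inside the unit ball.\<close>

lemma norm_psd_le_trace:
  assumes A: "psd A"
  shows "norm A \<le> Re (trace A)"
proof -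
  have t: "Re (trace A) = (\<Sum>i\<in>UNIV. Re (A $ i $ i))" by (simp add: trace_def)
  have "(norm A)\<^sup>2 = (\<Sum>i\<in>UNIV. \<Sum>j\<in>UNIV. (cmod (A $ i $ j))\<^sup>2)"
    by (simp add: norm_vec_def L2_set_def sum_nonneg)
  also have "\<dots> \<le> (\<Sum>i\<in>UNIV. \<Sum>j\<in>UNIV. Re (A $ i $ i) * Re (A $ j $ j))"
    by (intro sum_mono psd_offdiag_le A)
  also have "\<dots> = (Re (trace A))\<^sup>2" by (simp add: t power2_eq_square sum_product)
  finally show ?thesis
    by (rule power2_le_imp_le) (simp add: t sum_nonneg psd_diag_nonneg A)
qed

text \<open>After a congruence that diagonalises \<open>P\<close> and (with another congruence) Hadamard's
  inequality for \<open>P'\<close>, the tangent bound for \<open>log det\<close> reduces to \<open>ln x \<le> x - 1\<close> on the diagonal.\<close>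

lemma ln_det_tangent:
  fixes P P' :: "complex^'n^'n"
  assumes P: "psd P" "det P \<noteq> 0" and P': "psd P'" "det P' \<noteq> 0"
  shows "ln (Re (det P')) \<le> ln (Re (det P)) + Re (trace (matrix_inv P ** (P' - P)))"
proof -
  obtain L d where L: "det L = 1" "L ** P ** adjc L = (\<chi> i j. if i = j then of_real (d i) else 0)"
    "\<And>i. 0 \<le> d i" "\<And>i. d i \<le> Re (P $ i $ i)" by (rule psd_congruent_diagonal[OF P(1)]) (rule that)
  define M where "M = L ** P' ** adjc L"
  have M: "psd M" unfolding M_def by (rule psd_congruence[OF P'(1)])
  obtain K e where K: "det K = 1" "K ** M ** adjc K = (\<chi> i j. if i = j then of_real (e i) else 0)"
    "\<And>i. 0 \<le> e i" "\<And>i. e i \<le> Re (M $ i $ i)" by (rule psd_congruent_diagonal[OF M]) (rule that)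
  have "det P = det (L ** P ** adjc L)" by (simp add: det_mul det_adjc L(1))
  then have detP: "det P = of_real (\<Prod>i\<in>UNIV. d i)" by (simp add: L(2) det_of_real_diagonal)
  have "det P' = det (K ** M ** adjc K)" by (simp add: M_def det_mul det_adjc L(1) K(1))
  then have detP': "det P' = of_real (\<Prod>i\<in>UNIV. e i)" by (simp add: K(2) det_of_real_diagonal)
  have d: "d i > 0" for i using detP P(2) L(3)[of i] by (metis UNIV_I finite less_eq_real_def of_real_0 prod_zero)
  have e: "e i > 0" for i using detP' P'(2) K(3)[of i] by (metis UNIV_I finite less_eq_real_def of_real_0 prod_zero)
  \<comment> \<open>\<open>D'\<close> inverts the diagonalised \<open>P\<close>. Undoing the
    congruence gives \<open>matrix_inv P\<close>, and by cyclicity its trace against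
    \<open>P'\<close> sees only the diagonal of \<open>M\<close>.\<close>
  define D' :: "complex^'n^'n" where "D' = (\<chi> i j. if i = j then of_real (1 / d i) else 0)"
  have "D' ** (L ** P ** adjc L) = mat 1"
    unfolding L(2) D'_def using d[THEN less_imp_neq]
    by (simp add: vec_eq_iff matrix_matrix_mult_def mat_def if_distrib[of "\<lambda>x. _ * x"] cong: if_cong)
  then have "D' ** L ** P ** adjc L = mat 1" by (simp add: matrix_mul_assoc)
  then have "adjc L ** (D' ** L ** P) = mat 1" using matrix_left_right_inverse by blast
  then have inv: "matrix_inv P = adjc L ** D' ** L"
    by (intro matrix_inv_unique) (simp add: matrix_mul_assoc)
  have "trace (matrix_inv P ** P') = trace (adjc L ** (D' ** L ** P'))"
    by (simp add: inv matrix_mul_assoc)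
  also have "\<dots> = trace ((D' ** L ** P') ** adjc L)" by (rule trace_mul_sym)
  also have "\<dots> = trace (D' ** M)" by (simp add: M_def matrix_mul_assoc)
  also have "\<dots> = (\<Sum>i\<in>UNIV. M $ i $ i / of_real (d i))"
    by (simp add: trace_def matrix_matrix_mult_def D'_def if_distrib[of "\<lambda>x. x * _"] cong: if_cong)
  finally have tr: "Re (trace (matrix_inv P ** P')) = (\<Sum>i\<in>UNIV. Re (M $ i $ i) / d i)"
    by (simp cong: sum.cong)
  have "ln (Re (det P')) - ln (Re (det P)) = (\<Sum>i\<in>UNIV. ln (e i) - ln (d i))"
    using d e ln_prod[of UNIV d] ln_prod[of UNIV e]
    by (simp add: detP detP' sum_subtractf less_imp_neq[symmetric] del: of_real_prod)
  also have "\<dots> \<le> (\<Sum>i\<in>UNIV. Re (M $ i $ i) / d i - 1)"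
  proof (rule sum_mono)
    fix i
    have "ln (e i) - ln (d i) = ln (e i / d i)" using d[of i] e[of i] by (simp add: ln_div)
    also have "\<dots> \<le> e i / d i - 1" using d e by (intro ln_le_minus_one) simp
    \<comment> \<open>Hadamard's inequality enters here, through
      \<open>e i \<le> Re (M $ i $ i)\<close>.\<close>
    also have "\<dots> \<le> Re (M $ i $ i) / d i - 1" using d K(4) by (simp add: divide_right_mono less_imp_le)
    finally show "ln (e i) - ln (d i) \<le> Re (M $ i $ i) / d i - 1" .
  qed
  \<comment> \<open>The subtracted ones add up to the trace of
    \<open>matrix_inv P ** P\<close>.\<close>
  also have "\<dots> = Re (trace (matrix_inv P ** P')) - of_nat CARD('n)"
    by (simp add: tr sum_subtractf)
  also have "\<dots> = Re (trace (matrix_inv P ** (P' - P)))"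
    by (simp add: matrix_mult_diff_right trace_sub matrix_inv_inverse[OF P(2)] trace_I)
  finally show ?thesis by simp
qed

section \<open>Concavity of the energy efficiency\<close>

text \<open>On a kernel vector \<open>x\<close> the quadratic form of \<open>mat 1 + A\<close> is
  zero, yet it is at least \<open>(norm x)\<^sup>2\<close>.\<close>

lemma det_mat_1_plus_psd_nonzero:
  fixes A :: "complex^'n^'n"
  assumes "psd A"
  shows "det (mat 1 + A) \<noteq> 0"
proof
  assume "det (mat 1 + A) = 0"
  then obtain x where x: "x \<noteq> 0" "(mat 1 + A) *v x = 0"
    using invertible_det_nz[of "mat 1 + A"]
    by (metis invertible_left_inverse matrix_left_invertible_ker)
  have "0 = Re (cinner x ((mat 1 + A) *v x))" by (simp add: x cinner_def)
  also have "\<dots> = (norm x)\<^sup>2 + Re (cinner x (A *v x))"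
    by (simp add: Re_cinner_self[symmetric] cinner_def matrix_vector_mult_add_rdistrib distrib_left sum.distrib)
  also have "\<dots> > 0" using x assms by (auto simp: psd_iff_cinner intro: add_pos_nonneg)
  finally show False by simp
qed

lemma psd_rate_matrix:
  assumes "psd Q"
  shows "psd (mat 1 + H ** Q ** adjc H)" "det (mat 1 + H ** Q ** adjc H) \<noteq> 0"
    "0 < Re (det (mat 1 + H ** Q ** adjc H))"
proof -
  show 1: "psd (mat 1 + H ** Q ** adjc H)" "det (mat 1 + H ** Q ** adjc H) \<noteq> 0"
    using assms by (auto intro!: psd_add psd_mat_1 psd_congruence det_mat_1_plus_psd_nonzero)
  then show "0 < Re (det (mat 1 + H ** Q ** adjc H))"
    using psd_det_real[OF 1(1)] by (metis less_eq_real_def of_real_0)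
qed

text \<open>The matrix \<open>A\<close> inside \<open>gradV\<close>: the gradient of
  \<open>rate H\<close> at \<open>Q\<close> for the real Frobenius inner product.\<close>

definition rate_grad :: "complex^('k::finite \<times> 'm::finite)^('k \<times> 'n::finite) \<Rightarrow> complex^('k \<times> 'm)^('k \<times> 'm)
    \<Rightarrow> complex^('k \<times> 'm)^('k \<times> 'm)" where
  "rate_grad H Q = adjc H ** matrix_inv (mat 1 + H ** Q ** adjc H) ** H"

text \<open>\<open>Q\<close> enters the determinant affinely, so the tangent bound for log det
  carries over; cyclicity of the trace collects both channel factors in the gradient.\<close>

lemma rate_tangent:
  assumes Q: "psd Q" and Q': "psd Q'"
  shows "rate H Q' \<le> rate H Q + inner (rate_grad H Q) (Q' - Q)"
proof -
  define P P' where "P = mat 1 + H ** Q ** adjc H" and "P' = mat 1 + H ** Q' ** adjc H"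
  have h: "hermitian (Q' - Q)"
    using psd_hermitian[OF Q] psd_hermitian[OF Q'] by (simp add: hermitian_def vec_eq_iff)
  have "rate H Q' \<le> rate H Q + Re (trace (matrix_inv P ** (P' - P)))"
    unfolding rate_def P_def P'_def by (intro ln_det_tangent psd_rate_matrix assms)
  also have "P' - P = H ** (Q' - Q) ** adjc H"
    by (simp add: P_def P'_def matrix_mult_diff_right matrix_mult_diff_left)
  also have "trace (matrix_inv P ** (H ** (Q' - Q) ** adjc H)) = trace ((matrix_inv P ** H ** (Q' - Q)) ** adjc H)"
    by (simp add: matrix_mul_assoc)
  also have "\<dots> = trace (adjc H ** (matrix_inv P ** H ** (Q' - Q)))" by (rule trace_mul_sym)
  also have "\<dots> = trace (rate_grad H Q ** (Q' - Q))" by (simp add: rate_grad_def P_def matrix_mul_assoc)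
  finally show ?thesis by (simp add: inner_eq_trace[OF h])
qed

lemma XSetD:
  assumes "X \<in> XSet"
  shows "psd X" "hermitian X" "0 \<le> Re (trace X)" "Re (trace X) \<le> 1" "norm X \<le> 1"
proof -
  show 1: "psd X" "Re (trace X) \<le> 1" using assms by (auto simp: XSet_def)
  show "hermitian X" by (rule psd_hermitian[OF 1(1)])
  show "0 \<le> Re (trace X)" using 1 by (auto simp: trace_def intro!: sum_nonneg psd_diag_nonneg)
  show "norm X \<le> 1" using norm_psd_le_trace[OF 1(1)] 1(2) by simp
qed

text \<open>The triangle inequality would only give 4. Psd matrices have nonnegative inner product,
  so the cross term helps; half the squared distance is then at most 1.\<close>

lemma XSet_dist_le:
  assumes "X \<in> XSet" "Y \<in> XSet"
  shows "(norm (X - Y))\<^sup>2 \<le> 2"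
proof -
  have "(norm (X - Y))\<^sup>2 = (norm X)\<^sup>2 + (norm Y)\<^sup>2 - 2 * inner X Y"
    by (simp add: power2_norm_eq_inner inner_commute algebra_simps)
  moreover have "(norm X)\<^sup>2 \<le> 1" "(norm Y)\<^sup>2 \<le> 1" using assms[THEN XSetD(5)] by (simp_all add: power_le_one)
  moreover have "0 \<le> inner X Y" using assms by (intro inner_psd_nonneg XSetD(1))
  ultimately show ?thesis by simp
qed

lemma inner_mat_1: "hermitian B \<Longrightarrow> inner (mat 1) B = Re (trace B)"
  by (simp add: inner_eq_trace)

lemma trace_scaleR: "trace (c *\<^sub>R A) = c *\<^sub>R trace (A :: complex^'n^'n)"
  by (simp add: trace_def scaleR_sum_right)

lemma Qmap_psd:
  assumes "Pc > 0" "Pmax > 0" "X \<in> XSet"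
  shows "psd (Qmap Pc Pmax X)"
  unfolding Qmap_def using assms XSetD[OF assms(3)]
  by (intro psd_scaleR) (auto intro!: divide_nonneg_nonneg add_nonneg_nonneg mult_nonneg_nonneg)

text \<open>Every comparator in \<open>QSet\<close> has a preimage in \<open>XSet\<close>, so bounds
  proved in the coordinate \<open>X\<close> control the supremum over \<open>QSet\<close>.\<close>

lemma Qmap_surj:
  assumes "Pc > 0" "Pmax > 0" "Q \<in> QSet Pmax"
  obtains X where "X \<in> XSet" "Qmap Pc Pmax X = Q"
proof -
  define q where "q = Re (trace Q)"
  \<comment> \<open>Solving \<open>q = Pc * Pmax * t / (Pc + Pmax * (1 - t))\<close> for the trace
    \<open>t = c * q\<close> of the preimage gives this \<open>c\<close>; then
    \<open>q \<le> Pmax\<close> becomes \<open>c * q \<le> 1\<close>.\<close>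
  define c where "c = (Pc + Pmax) / (Pmax * (Pc + q))"
  have Q: "block_diag Q" "psd Q" "q \<le> Pmax" using assms by (auto simp: QSet_def q_def)
  have q0: "0 \<le> q" using Q(2) by (auto simp: q_def trace_def intro!: sum_nonneg psd_diag_nonneg)
  then have c0: "c > 0" using assms by (simp add: c_def)
  have t: "Re (trace (c *\<^sub>R Q)) = c * q" by (simp add: trace_scaleR q_def)
  have pos: "0 < Pmax * (Pc + q)" using assms q0 by simp
  have "(Pc + Pmax) * q \<le> Pmax * (Pc + q)" using assms Q(3) by (simp add: algebra_simps)
  then have "c * q \<le> 1" using pos by (simp add: c_def divide_simps)
  then have X: "c *\<^sub>R Q \<in> XSet"
    using Q c0 t by (auto simp: XSet_def psd_scaleR block_diag_def)
  have "Pc + q \<noteq> 0" using assms q0 by simp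
  then have "1 - c * q = Pc * (Pmax - q) / (Pmax * (Pc + q))"
    using pos assms by (simp add: c_def field_simps)
  then have "Pc + Pmax * (1 - c * q) = Pc + Pc * (Pmax - q) / (Pc + q)"
    using assms by simp
  also have "\<dots> = Pc * Pmax * c"
  proof -
    have "Pc * Pmax * c = Pc * (Pc + Pmax) / (Pc + q)" using assms(2) by (simp add: c_def)
    then show ?thesis using \<open>Pc + q \<noteq> 0\<close> by (simp add: field_simps)
  qed
  finally have "Pc * Pmax / (Pc + Pmax * (1 - c * q)) * c = 1"
    using assms(1,2) c0 by simp
  then have "Qmap Pc Pmax (c *\<^sub>R Q) = Q" unfolding Qmap_def t
    by (simp only: scaleR_scaleR scaleR_one)
  then show ?thesis using X that by blast
qed

text \<open>In the coordinate \<open>X\<close> the energy efficiency is the perspective \<open>s R(X / s)\<close> of the concave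
  rate function, with \<open>s\<close> affine in \<open>X\<close>; hence it is concave.\<close>

lemma EE_Qmap:
  assumes "Pc > 0" "Pmax > 0" "X \<in> XSet"
  defines "s \<equiv> (Pc + Pmax * (1 - Re (trace X))) / (Pc * Pmax)"
  shows "s > 0" "X = s *\<^sub>R Qmap Pc Pmax X"
    "EE Pc H (Qmap Pc Pmax X) = Pmax / (Pc + Pmax) * (s * rate H (Qmap Pc Pmax X))"
proof -
  define t where "t = Re (trace X)"
  have w: "0 < Pc + Pmax * (1 - t)" using assms XSetD[OF assms(3)]
    by (auto simp: t_def intro!: add_pos_nonneg)
  then show s: "s > 0" using assms by (simp add: s_def t_def)
  have Q: "Qmap Pc Pmax X = (1 / s) *\<^sub>R X" using w by (simp add: Qmap_def s_def t_def)
  then show "X = s *\<^sub>R Qmap Pc Pmax X" using s by simp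
  have "Re (trace (Qmap Pc Pmax X)) = t / s" by (simp add: Q trace_scaleR t_def)
  \<comment> \<open>The denominator of \<open>EE\<close> is a constant divided by \<open>s\<close>,
    so the quotient becomes a product with \<open>s\<close>.\<close>
  also have "Pc + t / s = (Pc + Pmax) / (Pmax * s)"
  proof -
    have "Pc * s + t = (Pc + Pmax) / Pmax"
      using assms by (simp add: s_def t_def field_simps)
    moreover have "Pc + t / s = (Pc * s + t) / s" using s by (simp add: add_divide_distrib)
    ultimately show ?thesis by simp
  qed
  finally show "EE Pc H (Qmap Pc Pmax X) = Pmax / (Pc + Pmax) * (s * rate H (Qmap Pc Pmax X))"
    by (simp add: EE_def)
qed

text \<open>The tangent inequality of a perspective: \<open>rate_tangent\<close> at \<open>Q\<close>
  is scaled by \<open>s'\<close>. The change of scale \<open>s' - s\<close> is a multiple of the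
  trace of \<open>X' - X\<close>, which is where the identity term of \<open>gradV\<close> comes
  from.\<close>

lemma EE_Qmap_tangent:
  assumes Pc: "Pc > 0" and Pmax: "Pmax > 0" and X: "X \<in> XSet" and X': "X' \<in> XSet"
  shows "EE Pc H (Qmap Pc Pmax X') - EE Pc H (Qmap Pc Pmax X) \<le> inner (gradV Pc Pmax H X) (X' - X)"
proof -
  define Q Q' where "Q = Qmap Pc Pmax X" and "Q' = Qmap Pc Pmax X'"
  define s where "s = (Pc + Pmax * (1 - Re (trace X))) / (Pc * Pmax)"
  define s' where "s' = (Pc + Pmax * (1 - Re (trace X'))) / (Pc * Pmax)"
  define A where "A = rate_grad H Q"
  define R where "R = rate H Q"
  have s: "s > 0" "X = s *\<^sub>R Q" "EE Pc H Q = Pmax / (Pc + Pmax) * (s * R)"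
    using EE_Qmap(1,2)[OF Pc Pmax X] EE_Qmap(3)[OF Pc Pmax X, of H] unfolding s_def Q_def R_def by blast+
  have s': "s' > 0" "X' = s' *\<^sub>R Q'" "EE Pc H Q' = Pmax / (Pc + Pmax) * (s' * rate H Q')"
    using EE_Qmap(1,2)[OF Pc Pmax X'] EE_Qmap(3)[OF Pc Pmax X', of H] unfolding s'_def Q'_def by blast+
  have psd: "psd Q" "psd Q'" by (auto simp: Q_def Q'_def intro!: Qmap_psd assms)
  have ss: "s' - s = - Re (trace (X' - X)) / Pc"
    using Pc Pmax by (simp add: s_def s'_def trace_sub field_simps)
  have h: "hermitian (X' - X)"
    using XSetD(2)[OF X] XSetD(2)[OF X'] by (simp add: hermitian_def vec_eq_iff)
  have "s' * rate H Q' - s * R \<le> s' * (R + inner A (Q' - Q)) - s * R"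
    using rate_tangent[OF psd] s'(1) by (simp add: A_def R_def)
  \<comment> \<open>Since \<open>X = s *\<^sub>R Q\<close> and \<open>X' = s' *\<^sub>R Q'\<close>,
    the increment \<open>s' *\<^sub>R (Q' - Q)\<close> is
    \<open>(X' - X) - (s' - s) *\<^sub>R Q\<close>.\<close>
  also have "\<dots> = inner A (X' - X) + (s' - s) * (R - inner A Q)"
    using s(2) s'(2) by (simp add: algebra_simps)
  also have "\<dots> = inner A (X' - X) + (inner A Q - R) / Pc * Re (trace (X' - X))"
    by (simp add: ss minus_divide_left[symmetric] left_diff_distrib right_diff_distrib diff_divide_distrib
        mult.commute)
  also have "\<dots> = inner (A + ((Re (trace (A ** Q)) - R) / Pc) *\<^sub>R mat 1) (X' - X)"
    by (simp add: inner_add_left inner_mat_1[OF h] inner_eq_trace[OF psd_hermitian[OF psd(1)]])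
  finally have "Pmax / (Pc + Pmax) * (s' * rate H Q' - s * R) \<le>
      Pmax / (Pc + Pmax) * inner (A + ((Re (trace (A ** Q)) - R) / Pc) *\<^sub>R mat 1) (X' - X)"
    using Pc Pmax by (intro mult_left_mono) auto
  then show ?thesis
    using s(3) s'(3)
    by (simp add: gradV_def Let_def Q_def Q'_def A_def R_def rate_grad_def right_diff_distrib)
qed

section \<open>Topology of the feasible set, its projection, and continuity of rate and
  gradient\<close>

lemma convex_XSet: "convex XSet"
proof (rule convexI)
  fix x y :: "complex^('a \<times> 'b)^('a \<times> 'b)" and u v :: real
  assume *: "x \<in> XSet" "y \<in> XSet" "0 \<le> u" "0 \<le> v" "u + v = 1"
  have "u * Re (trace x) + v * Re (trace y) \<le> u * 1 + v * 1"
    using * XSetD by (intro add_mono mult_left_mono) auto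
  then show "u *\<^sub>R x + v *\<^sub>R y \<in> XSet"
    using * by (auto simp: XSet_def block_diag_def trace_add trace_scaleR intro!: psd_add psd_scaleR)
qed

lemma closed_XSet: "closed XSet"
  unfolding XSet_def block_diag_def psd_def hermitian_def trace_def vec_eq_iff adjc_nth
  by (intro closed_Collect_conj closed_Collect_all closed_Collect_imp open_Collect_const
      closed_Collect_le closed_Collect_eq continuous_intros)

lemma compact_XSet: "compact XSet"
  using closed_XSet XSetD(5) by (auto simp: compact_eq_bounded_closed bounded_iff)

lemma proj_eq_closest_point: "proj = closest_point XSet"
  by (simp add: fun_eq_iff proj_def closest_point_def dist_norm norm_minus_commute)

lemma zero_in_XSet: "0 \<in> XSet"
  by (simp add: XSet_def block_diag_def psd_def hermitian_def vec_eq_iff trace_def)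

lemma proj_in_XSet: "proj Y \<in> XSet"
  unfolding proj_eq_closest_point using zero_in_XSet by (intro closest_point_in_set closed_XSet) auto

lemma continuous_on_proj: "continuous_on S proj"
  unfolding proj_eq_closest_point using zero_in_XSet
  by (intro continuous_on_closest_point closed_XSet convex_XSet) auto

lemma norm_proj_diff_le:
  assumes "Z \<in> XSet"
  shows "norm (proj Y - Z) \<le> norm (Y - Z)"
  using closest_point_lipschitz[OF convex_XSet closed_XSet, of Y Z] assms closest_point_self[OF assms]
  by (auto simp: proj_eq_closest_point dist_norm)

lemma continuous_on_matrix_mult:
  fixes A :: "'t::topological_space \<Rightarrow> complex^'n^'m" and B :: "'t \<Rightarrow> complex^'p^'n"
  assumes "continuous_on S A" "continuous_on S B"
  shows "continuous_on S (\<lambda>x. A x ** B x)"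
  unfolding matrix_matrix_mult_def
  by (intro continuous_on_vec_lambda continuous_intros assms)

lemma continuous_on_complex_det:
  fixes A :: "'t::topological_space \<Rightarrow> complex^'n^'n"
  assumes "continuous_on S A"
  shows "continuous_on S (\<lambda>x. det (A x))"
  unfolding det_def by (intro continuous_intros assms)

text \<open>\<open>matrix_inv\<close> is a choice of an inverse; Cramer's rule makes its entries
  quotients of determinants, from which continuity is read off.\<close>

lemma matrix_inv_cramer:
  fixes A :: "complex^'n^'n"
  assumes "det A \<noteq> 0"
  shows "matrix_inv A = (\<chi> k l. det (\<chi> i j. if j = k then (if i = l then 1 else 0) else A $ i $ j) / det A)"
proof -
  have "(matrix_inv A) $ k $ l = det (\<chi> i j. if j = k then (if i = l then 1 else 0) else A $ i $ j) / det A" for k l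
  proof -
    have "A *v (\<chi> m. (matrix_inv A) $ m $ l) = (\<chi> i. if i = l then 1 else 0)"
      using matrix_inv_inverse(2)[OF assms]
      by (simp add: vec_eq_iff matrix_matrix_mult_def matrix_vector_mult_def mat_def)
    then have "(\<chi> m. (matrix_inv A) $ m $ l) =
        (\<chi> k. det (\<chi> i j. if j = k then (\<chi> i. if i = l then 1 else 0) $ i else A $ i $ j) / det A)"
      using cramer[OF assms] by blast
    then show ?thesis by (simp add: vec_eq_iff cong: if_cong)
  qed
  then show ?thesis by (simp add: vec_eq_iff)
qed

lemma continuous_on_matrix_inv:
  fixes A :: "'t::topological_space \<Rightarrow> complex^'n^'n"
  assumes A: "continuous_on S A" and nz: "\<And>x. x \<in> S \<Longrightarrow> det (A x) \<noteq> 0"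
  shows "continuous_on S (\<lambda>x. matrix_inv (A x))"
proof -
  have "continuous_on S (\<lambda>x. (\<chi> k l. det (\<chi> i j. if j = k then (if i = l then 1 else 0) else A x $ i $ j) / det (A x)))"
  proof (intro continuous_on_vec_lambda continuous_on_divide continuous_on_complex_det A)
    fix k l i j
    show "continuous_on S (\<lambda>x. if j = k then (if i = l then 1 else 0) else A x $ i $ j)"
      by (cases "j = k") (auto intro!: continuous_intros A)
  qed (use nz in auto)
  then show ?thesis by (rule continuous_on_eq) (simp add: matrix_inv_cramer nz)
qed

lemma continuous_on_trace:
  fixes A :: "'t::topological_space \<Rightarrow> complex^'n^'n"
  assumes "continuous_on S A"
  shows "continuous_on S (\<lambda>x. trace (A x))"
  unfolding trace_def by (intro continuous_intros assms)

lemma continuous_on_Qmap: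
  assumes "Pc > 0" "Pmax > 0"
  shows "continuous_on XSet (Qmap Pc Pmax)"
  unfolding Qmap_def
proof (intro continuous_intros continuous_on_trace ballI)
  fix X assume "X \<in> XSet"
  from EE_Qmap(1)[OF assms this] assms show "Pc + Pmax * (1 - Re (trace X)) \<noteq> 0" by force
qed

lemma continuous_on_rate_Qmap:
  assumes "Pc > 0" "Pmax > 0"
  shows "continuous_on XSet (\<lambda>X. rate H (Qmap Pc Pmax X))"
  unfolding rate_def using psd_rate_matrix(3)[OF Qmap_psd[OF assms], of _ H]
  by (intro continuous_on_ln continuous_intros continuous_on_complex_det continuous_on_matrix_mult
     continuous_on_Qmap assms) force

lemma continuous_on_EE_Qmap:
  assumes "Pc > 0" "Pmax > 0"
  shows "continuous_on XSet (\<lambda>X. EE Pc H (Qmap Pc Pmax X))"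
proof -
  have "continuous_on XSet (\<lambda>X. Pmax / (Pc + Pmax) * ((Pc + Pmax * (1 - Re (trace X))) / (Pc * Pmax) * rate H (Qmap Pc Pmax X)))"
    using assms by (intro continuous_intros continuous_on_trace continuous_on_rate_Qmap) auto
  then show ?thesis by (rule continuous_on_eq) (simp add: EE_Qmap(3)[OF assms])
qed

lemma continuous_on_gradV:
  assumes "Pc > 0" "Pmax > 0"
  shows "continuous_on XSet (gradV Pc Pmax H)"
proof -
  have A: "continuous_on XSet (\<lambda>X. adjc H ** matrix_inv (mat 1 + H ** Qmap Pc Pmax X ** adjc H) ** H)"
    using psd_rate_matrix(2)[OF Qmap_psd[OF assms], of _ H]
    by (intro continuous_intros continuous_on_matrix_inv continuous_on_matrix_mult
     continuous_on_Qmap assms) force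
  have "continuous_on XSet (\<lambda>X. gradV Pc Pmax H X)"
    unfolding gradV_def Let_def using assms
    by (intro continuous_intros A continuous_on_trace continuous_on_matrix_mult[OF A]
      continuous_on_Qmap continuous_on_rate_Qmap) auto
  then show ?thesis .
qed

section \<open>Strong law for martingale noise\<close>

text \<open>Kronecker's lemma by dominated convergence for series: \<open>a k / T\<close> vanishes
  for each \<open>k\<close> as \<open>T\<close> grows, and for \<open>k \<le> T\<close> it is
  dominated by the summable \<open>a k / k\<close>.\<close>

lemma kronecker_nonneg:
  fixes a :: "nat \<Rightarrow> real"
  assumes a: "\<And>n. 0 \<le> a n" and sm: "summable (\<lambda>n. a n / real n)"
  shows "(\<lambda>T. (\<Sum>n = 1..T. a n) / real T) \<longlonglongrightarrow> 0"
proof -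
  \<comment> \<open>Index 0 is left out: there the dominating term is a division by zero, hence
    0.\<close>
  define f where "f k T = (if 1 \<le> k \<and> k \<le> T then a k / real T else 0)" for k T :: nat
  have "(\<lambda>T. \<Sum>k. f k T) \<longlonglongrightarrow> (\<Sum>k::nat. 0::real)"
  proof (rule tannerys_theorem[THEN conjunct2, THEN conjunct2])
    fix k
    have "(\<lambda>T. a k / real T) \<longlonglongrightarrow> 0" by real_asymp
    then show "(\<lambda>T. f k T) \<longlonglongrightarrow> 0"
      by (rule Lim_null_comparison[rotated]) (use a in \<open>auto simp: f_def\<close>)
  next
    have "norm (f k T) \<le> a k / real k" for k T
      using a by (auto simp: f_def intro!: divide_left_mono)
    then show "\<forall>\<^sub>F (k, n) in sequentially \<times>\<^sub>F sequentially. norm (f k n) \<le> a k / real k"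
      by (intro always_eventually) auto
  qed (use sm in simp_all)
  moreover have "(\<Sum>k. f k T) = (\<Sum>n = 1..T. a n) / real T" for T
    by (subst suminf_finite[of "{1..T}"]) (auto simp: f_def sum_divide_distrib)
  ultimately show ?thesis by simp
qed

text \<open>By Tonelli the sum has finite expectation, hence is almost surely finite. This is how
  moment bounds become pathwise convergence.\<close>

lemma AE_summable_of_summable_integral:
  fixes Y :: "nat \<Rightarrow> 'a \<Rightarrow> real"
  assumes int: "\<And>n. integrable M (Y n)" and nn: "\<And>n x. 0 \<le> Y n x"
    and bound: "\<And>n. (\<integral>x. Y n x \<partial>M) \<le> c n" and c: "summable c"
  shows "AE x in M. summable (\<lambda>n. Y n x)"
proof -
  have [measurable]: "Y n \<in> borel_measurable M" for n using int by auto
  have c0: "0 \<le> c n" for n using bound[of n] nn by (metis Bochner_Integration.integral_nonneg order_trans)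
  have "(\<integral>\<^sup>+x. (\<Sum>n. ennreal (Y n x)) \<partial>M) = (\<Sum>n. \<integral>\<^sup>+x. ennreal (Y n x) \<partial>M)"
    by (rule nn_integral_suminf) simp
  also have "\<dots> \<le> (\<Sum>n. ennreal (c n))"
    using int nn bound by (intro suminf_le summableI) (simp add: nn_integral_eq_integral ennreal_leI)
  also have "\<dots> = ennreal (\<Sum>n. c n)" by (rule suminf_ennreal2[OF c0 c])
  finally have "(\<integral>\<^sup>+x. (\<Sum>n. ennreal (Y n x)) \<partial>M) \<noteq> \<infinity>" by (auto simp: top_unique)
  then have "AE x in M. (\<Sum>n. ennreal (Y n x)) \<noteq> \<infinity>" by (intro nn_integral_PInf_AE) simp_all
  then show ?thesis by eventually_elim (auto intro: summable_suminf_not_top nn)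
qed

lemma integrable_prod_of_square:
  fixes f g :: "'a \<Rightarrow> real"
  assumes [measurable]: "f \<in> borel_measurable M" "g \<in> borel_measurable M"
    and "integrable M (\<lambda>x. (f x)\<^sup>2)" "integrable M (\<lambda>x. (g x)\<^sup>2)"
  shows "integrable M (\<lambda>x. f x * g x)"
proof (rule Bochner_Integration.integrable_bound[of M "\<lambda>x. (f x)\<^sup>2 + (g x)\<^sup>2"])
  have "\<bar>a * b\<bar> \<le> a\<^sup>2 + b\<^sup>2" for a b :: real
    using sum_squares_bound[of "\<bar>a\<bar>" "\<bar>b\<bar>"] mult_nonneg_nonneg[of "\<bar>a\<bar>" "\<bar>b\<bar>"]
    unfolding abs_mult power2_abs mult.assoc by linarith
  then show "AE x in M. norm (f x * g x) \<le> norm ((f x)\<^sup>2 + (g x)\<^sup>2)" by simp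
qed (use assms in auto)

text \<open>Strong law for orthogonal variables: Chebyshev's inequality controls the averages at the times
  \<open>k\<^sup>2\<close>, and the Cauchy-Schwarz inequality the fluctuation between \<open>k\<^sup>2\<close> and \<open>(k + 1)\<^sup>2\<close>.\<close>

lemma AE_average_orthogonal_tendsto_0:
  fixes \<xi> :: "nat \<Rightarrow> 'a \<Rightarrow> real"
  assumes meas [measurable]: "\<And>n. 1 \<le> n \<Longrightarrow> \<xi> n \<in> borel_measurable M"
    and int: "\<And>n. 1 \<le> n \<Longrightarrow> integrable M (\<lambda>x. (\<xi> n x)\<^sup>2)"
    and bound: "\<And>n. 1 \<le> n \<Longrightarrow> (\<integral>x. (\<xi> n x)\<^sup>2 \<partial>M) \<le> C"
    and orth: "\<And>m n. 1 \<le> m \<Longrightarrow> m < n \<Longrightarrow> (\<integral>x. \<xi> m x * \<xi> n x \<partial>M) = 0"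
  shows "AE x in M. (\<lambda>T. (\<Sum>n = 1..T. \<xi> n x) / real T) \<longlonglongrightarrow> 0"
proof -
  define S where "S T x = (\<Sum>n = 1..T. \<xi> n x)" for T x
  define D where "D k x = (\<Sum>n\<in>{k\<^sup>2<..(Suc k)\<^sup>2}. \<bar>\<xi> n x\<bar>)" for k x
  have C0: "0 \<le> C" by (rule order_trans[OF Bochner_Integration.integral_nonneg bound[OF order_refl]]) simp
  have prod: "integrable M (\<lambda>x. \<xi> m x * \<xi> n x)" if "1 \<le> m" "1 \<le> n" for m n
    using that by (intro integrable_prod_of_square meas int)
  have S2: "integrable M (\<lambda>x. (S T x)\<^sup>2)" "(\<integral>x. (S T x)\<^sup>2 \<partial>M) \<le> real T * C" for T
  proof -
    have eq: "(S T x)\<^sup>2 = (\<Sum>m = 1..T. \<Sum>n = 1..T. \<xi> m x * \<xi> n x)" for x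
      by (simp add: S_def power2_eq_square sum_product)
    show "integrable M (\<lambda>x. (S T x)\<^sup>2)" unfolding eq
      by (intro Bochner_Integration.integrable_sum prod) auto
    have "(\<integral>x. (S T x)\<^sup>2 \<partial>M) = (\<Sum>m = 1..T. \<Sum>n = 1..T. \<integral>x. \<xi> m x * \<xi> n x \<partial>M)"
      unfolding eq using prod
      by (subst Bochner_Integration.integral_sum, auto)+
    \<comment> \<open>Orthogonality removes the cross terms, so the second moment grows only
      linearly in \<open>T\<close>.\<close>
    also have "\<dots> = (\<Sum>m = 1..T. \<Sum>n = 1..T. if m = n then (\<integral>x. (\<xi> m x)\<^sup>2 \<partial>M) else 0)"
    proof (intro sum.cong refl)
      fix m n assume "m \<in> {1..T}" "n \<in> {1..T}"
      then show "(\<integral>x. \<xi> m x * \<xi> n x \<partial>M) = (if m = n then (\<integral>x. (\<xi> m x)\<^sup>2 \<partial>M) else 0)"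
        using orth[of m n] orth[of n m] by (cases m n rule: linorder_cases) (auto simp: power2_eq_square mult.commute)
    qed
    also have "\<dots> = (\<Sum>m = 1..T. \<integral>x. (\<xi> m x)\<^sup>2 \<partial>M)" by simp
    also have "\<dots> \<le> (\<Sum>m = 1..T. C)" by (intro sum_mono bound) auto
    finally show "(\<integral>x. (S T x)\<^sup>2 \<partial>M) \<le> real T * C" by simp
  qed
  have D2: "integrable M (\<lambda>x. (D k x)\<^sup>2)" "(\<integral>x. (D k x)\<^sup>2 \<partial>M) \<le> (real (2 * k + 1))\<^sup>2 * C" for k
  proof -
    let ?I = "{k\<^sup>2<..(Suc k)\<^sup>2}"
    have card: "card ?I = 2 * k + 1" by (simp add: power2_eq_square)
    have le: "(D k x)\<^sup>2 \<le> (\<Sum>n\<in>?I. (\<xi> n x)\<^sup>2) * real (2 * k + 1)" for x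
      using sum_squared_le_sum_of_squares[of "\<lambda>n. \<bar>\<xi> n x\<bar>" ?I] unfolding D_def card by simp
    have i: "integrable M (\<lambda>x. (\<Sum>n\<in>?I. (\<xi> n x)\<^sup>2) * real (2 * k + 1))"
      by (intro integrable_mult_left Bochner_Integration.integrable_sum int) auto
    have [measurable]: "D k \<in> borel_measurable M"
      unfolding D_def by (intro borel_measurable_sum borel_measurable_abs meas) auto
    show j: "integrable M (\<lambda>x. (D k x)\<^sup>2)"
      by (rule Bochner_Integration.integrable_bound[OF i]) (use le in \<open>auto intro: order_trans[OF _ abs_ge_self]\<close>)
    have "(\<integral>x. (D k x)\<^sup>2 \<partial>M) \<le> (\<integral>x. (\<Sum>n\<in>?I. (\<xi> n x)\<^sup>2) * real (2 * k + 1) \<partial>M)"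
      by (intro integral_mono i j le)
    also have "\<dots> = (\<Sum>n\<in>?I. \<integral>x. (\<xi> n x)\<^sup>2 \<partial>M) * real (2 * k + 1)"
      using int by (simp only: integral_mult_left_zero) (subst Bochner_Integration.integral_sum, auto)
    also have "\<dots> \<le> (\<Sum>n\<in>?I. C) * real (2 * k + 1)"
      by (intro mult_right_mono sum_mono bound) auto
    also have "\<dots> = (real (2 * k + 1))\<^sup>2 * C" unfolding sum_constant card by (simp add: power2_eq_square)
    finally show "(\<integral>x. (D k x)\<^sup>2 \<partial>M) \<le> (real (2 * k + 1))\<^sup>2 * C" .
  qed
  have sq: "summable (\<lambda>k. c / (real k)\<^sup>2)" for c
    using summable_mult[OF inverse_power_summable[of 2, where 'a=real], of c] by (simp add: field_simps)
  \<comment> \<open>The second moment at time \<open>k\<^sup>2\<close> is at most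
    \<open>C * k\<^sup>2\<close>; after division by the fourth power of \<open>k\<close> it is
    summable.\<close>
  have "AE x in M. summable (\<lambda>k. (S (k\<^sup>2) x / (real k)\<^sup>2)\<^sup>2)"
  proof (rule AE_summable_of_summable_integral[OF _ _ _ sq[of C]])
    fix k
    show "integrable M (\<lambda>x. (S (k\<^sup>2) x / (real k)\<^sup>2)\<^sup>2)"
      using S2(1) by (simp add: power_divide)
    have "(\<integral>x. (S (k\<^sup>2) x / (real k)\<^sup>2)\<^sup>2 \<partial>M) = (\<integral>x. (S (k\<^sup>2) x)\<^sup>2 \<partial>M) / (real k)^4"
      by (simp add: power_divide)
    also have "\<dots> \<le> (real (k\<^sup>2) * C) / (real k)^4" by (intro divide_right_mono S2(2)) simp
    also have "\<dots> = C / (real k)\<^sup>2"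
      by (cases "k = 0") (simp_all add: field_simps power2_eq_square power4_eq_xxxx)
    finally show "(\<integral>x. (S (k\<^sup>2) x / (real k)\<^sup>2)\<^sup>2 \<partial>M) \<le> C / (real k)\<^sup>2" .
  qed simp
  moreover have "AE x in M. summable (\<lambda>k. (D k x / (real k)\<^sup>2)\<^sup>2)"
  proof (rule AE_summable_of_summable_integral[OF _ _ _ sq[of "9 * C"]])
    fix k
    show "integrable M (\<lambda>x. (D k x / (real k)\<^sup>2)\<^sup>2)"
      using D2(1) by (simp add: power_divide)
    show "(\<integral>x. (D k x / (real k)\<^sup>2)\<^sup>2 \<partial>M) \<le> 9 * C / (real k)\<^sup>2"
    proof (cases "k = 0")
      case False
      have "(\<integral>x. (D k x / (real k)\<^sup>2)\<^sup>2 \<partial>M) = (\<integral>x. (D k x)\<^sup>2 \<partial>M) / (real k)^4"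
        by (simp add: power_divide)
      also have "\<dots> \<le> ((real (2 * k + 1))\<^sup>2 * C) / (real k)^4" by (intro divide_right_mono D2(2)) simp
      \<comment> \<open>The 9 comes from \<open>2 * k + 1 \<le> 3 * k\<close> for
        \<open>k \<ge> 1\<close>.\<close>
      also have "\<dots> \<le> ((3 * real k)\<^sup>2 * C) / (real k)^4"
        using False C0 by (intro divide_right_mono mult_right_mono power_mono) auto
      also have "\<dots> = 9 * C / (real k)\<^sup>2"
        using False by (simp add: field_simps power2_eq_square power4_eq_xxxx)
      finally show ?thesis .
    qed simp
  qed simp
  ultimately show ?thesis
  proof eventually_elim
    fix x
    assume 1: "summable (\<lambda>k. (S (k\<^sup>2) x / (real k)\<^sup>2)\<^sup>2)" and 2: "summable (\<lambda>k. (D k x / (real k)\<^sup>2)\<^sup>2)"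
    \<comment> \<open>\<open>g\<close> at \<open>k = floor_sqrt T\<close> dominates the average at
      \<open>T\<close>: \<open>D k\<close> covers the terms after \<open>k\<^sup>2\<close>, and
      replacing the divisor \<open>T\<close> by the smaller \<open>k\<^sup>2\<close> only enlarges
      the quotient.\<close>
    define g where "g k = \<bar>S (k\<^sup>2) x / (real k)\<^sup>2\<bar> + \<bar>D k x / (real k)\<^sup>2\<bar>" for k
    have "g \<longlonglongrightarrow> 0"
      using tendsto_add[OF tendsto_real_sqrt[OF summable_LIMSEQ_zero[OF 1]] tendsto_real_sqrt[OF summable_LIMSEQ_zero[OF 2]]]
      unfolding g_def by simp
    moreover have "filterlim floor_sqrt sequentially sequentially"
      unfolding filterlim_at_top eventually_sequentially
      by (metis floor_sqrt_inverse_power2 mono_floor_sqrt')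
    ultimately have lim: "(\<lambda>T. g (floor_sqrt T)) \<longlonglongrightarrow> 0"
      by (rule filterlim_compose)
    have "norm (S T x / real T) \<le> g (floor_sqrt T)" if T: "T \<ge> 1" for T
    proof -
      define k where "k = floor_sqrt T"
      have k: "k \<ge> 1" "k\<^sup>2 \<le> T" "T < (Suc k)\<^sup>2"
        using T by (auto simp: k_def Suc_floor_sqrt_power2_gt Suc_le_eq)
      have "S T x = S (k\<^sup>2) x + (\<Sum>n\<in>{k\<^sup>2<..T}. \<xi> n x)"
        unfolding S_def using k by (subst sum.union_disjoint[symmetric]) (auto intro!: sum.cong)
      moreover have "\<bar>\<Sum>n\<in>{k\<^sup>2<..T}. \<xi> n x\<bar> \<le> D k x"
        unfolding D_def using k by (intro order_trans[OF sum_abs] sum_mono2) auto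
      ultimately have "\<bar>S T x\<bar> \<le> \<bar>S (k\<^sup>2) x\<bar> + \<bar>D k x\<bar>" by linarith
      then have "\<bar>S T x\<bar> / real T \<le> (\<bar>S (k\<^sup>2) x\<bar> + \<bar>D k x\<bar>) / (real k)\<^sup>2"
        using k T by (intro frac_le) (auto simp flip: of_nat_power)
      then show ?thesis by (simp add: g_def k_def add_divide_distrib)
    qed
    then have "(\<lambda>T. S T x / real T) \<longlonglongrightarrow> 0"
      by (intro Lim_null_comparison[OF _ lim] eventually_sequentiallyI[of 1])
    then show "(\<lambda>T. (\<Sum>n = 1..T. \<xi> n x) / real T) \<longlonglongrightarrow> 0" by (simp add: S_def)
  qed
qed

text \<open>Dyadic layers: for \<open>2 ^ k \<le> Z x < 2 ^ Suc k\<close> the square is at most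
  \<open>4 ^ Suc k\<close>, while the tail bound gives \<open>B * 2 powr (- \<beta> * k)\<close>.
  The geometric ratio \<open>4 * 2 powr - \<beta>\<close> is below 1 because \<beta> > 2; the
  leading 1 covers \<open>Z x < 1\<close>.\<close>

lemma (in prob_space) second_moment_of_tail:
  fixes Z :: "'a \<Rightarrow> real"
  assumes [measurable]: "Z \<in> borel_measurable M" and Z0: "\<And>x. 0 \<le> Z x" and \<beta>: "\<beta> > 2" and B: "B \<ge> 0"
    and tail: "\<And>z. z > 0 \<Longrightarrow> prob {x \<in> space M. z \<le> Z x} \<le> B / z powr \<beta>"
  shows "integrable M (\<lambda>x. (Z x)\<^sup>2)"
    "expectation (\<lambda>x. (Z x)\<^sup>2) \<le> 1 + 4 * B / (1 - 4 * 2 powr - \<beta>)"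
proof -
  define A where "A k = {x \<in> space M. 2 ^ k \<le> Z x}" for k :: nat
  define q where "q = 4 * 2 powr - \<beta>"
  have [measurable]: "A k \<in> sets M" for k unfolding A_def by measurable
  have "(2::real) powr - \<beta> < 2 powr - 2" using \<beta> by (intro powr_less_mono) auto
  then have q: "0 < q" "q < 1" by (auto simp: q_def powr_minus powr_numeral)
  have pw: "ennreal ((Z x)\<^sup>2) \<le> 1 + (\<Sum>k. ennreal (4 ^ Suc k) * indicator (A k) x)" if x: "x \<in> space M" for x
  proof (cases "Z x < 1")
    case True
    then have "(Z x)\<^sup>2 \<le> 1" using Z0 by (simp add: power_le_one)
    then have "ennreal ((Z x)\<^sup>2) \<le> 1" by simp
    then show ?thesis by (simp add: add_increasing2)
  next
    case False
    define k where "k = nat \<lfloor>log 2 (Z x)\<rfloor>"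
    have "0 \<le> \<lfloor>log 2 (Z x)\<rfloor>" using False by simp
    then have k: "real k \<le> log 2 (Z x)" "log 2 (Z x) < real (Suc k)" by (auto simp: k_def) linarith
    have "2 ^ k \<le> Z x" "Z x < 2 ^ Suc k"
      using k False by (auto simp: le_log_iff log_less_iff powr_realpow simp del: of_nat_Suc power_Suc)
    then have xA: "x \<in> A k" and le: "(Z x)\<^sup>2 \<le> 4 ^ Suc k"
      using x Z0[of x] power_mono[of "Z x" "2 ^ Suc k" 2] by (auto simp: A_def power_mult_distrib[symmetric] power2_eq_square power_mult)
    have "ennreal ((Z x)\<^sup>2) \<le> ennreal (4 ^ Suc k) * indicator (A k) x" using le xA by (simp add: ennreal_leI)
    also have "\<dots> \<le> (\<Sum>k. ennreal (4 ^ Suc k) * indicator (A k) x)"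
    proof -
      have "f k \<le> suminf f" for f :: "nat \<Rightarrow> ennreal"
        using sum_le_suminf[of f "{k}"] by (simp add: summableI)
      then show ?thesis .
    qed
    finally show ?thesis by (simp add: add_increasing)
  qed
  have "(\<integral>\<^sup>+x. ennreal ((Z x)\<^sup>2) \<partial>M) \<le> (\<integral>\<^sup>+x. 1 + (\<Sum>k. ennreal (4 ^ Suc k) * indicator (A k) x) \<partial>M)"
    by (intro nn_integral_mono pw)
  also have "\<dots> = 1 + (\<Sum>k. ennreal (4 ^ Suc k) * emeasure M (A k))"
    by (simp add: nn_integral_add nn_integral_suminf nn_integral_cmult emeasure_space_1 del: power_Suc)
  also have "\<dots> \<le> 1 + (\<Sum>k. ennreal (4 * B * q ^ k))"
  proof (intro add_left_mono suminf_le summableI)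
    fix k
    have "ennreal (4 ^ Suc k) * emeasure M (A k) = ennreal (4 ^ Suc k * prob (A k))"
      by (simp add: emeasure_eq_measure ennreal_mult)
    also have "\<dots> \<le> ennreal (4 ^ Suc k * (B / (2 ^ k) powr \<beta>))"
      using tail[of "2 ^ k"] by (intro ennreal_leI mult_left_mono) (auto simp: A_def)
    also have "4 ^ Suc k * (B / (2 ^ k) powr \<beta>) = 4 * B * q ^ k"
    proof -
      have "(2 ^ k) powr \<beta> = (2 powr \<beta>) ^ k"
        by (simp add: powr_realpow[symmetric] powr_powr mult.commute powr_power)
      then show ?thesis by (simp add: q_def powr_minus power_mult_distrib power_inverse divide_inverse)
    qed
    finally show "ennreal (4 ^ Suc k) * emeasure M (A k) \<le> ennreal (4 * B * q ^ k)" .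
  qed
  also have "(\<Sum>k. ennreal (4 * B * q ^ k)) = ennreal (4 * B * (1 / (1 - q)))"
    using q B by (intro suminf_ennreal_eq sums_mult geometric_sums) auto
  also have "1 + \<dots> = ennreal (1 + 4 * B / (1 - q))"
    using q B by (simp add: ennreal_plus del: ennreal_plus[symmetric])
  finally have main: "(\<integral>\<^sup>+x. ennreal ((Z x)\<^sup>2) \<partial>M) \<le> ennreal (1 + 4 * B / (1 - q))" .
  then show i: "integrable M (\<lambda>x. (Z x)\<^sup>2)"
    by (intro integrableI_nonneg) (auto intro: le_less_trans)
  have "0 \<le> 1 + 4 * B / (1 - q)" using q B by simp
  with main show "expectation (\<lambda>x. (Z x)\<^sup>2) \<le> 1 + 4 * B / (1 - 4 * 2 powr - \<beta>)"
    by (simp add: nn_integral_eq_integral[OF i] q_def)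
qed

text \<open>Pairing vector noise with predictable weights in the unit ball gives orthogonal scalar
  variables. The weights used later are constant basis vectors and the iterates themselves.\<close>

lemma AE_average_martingale_noise:
  fixes \<xi> w :: "nat \<Rightarrow> 'w \<Rightarrow> 'a::euclidean_space"
  assumes sub: "\<And>n. subalgebra M (F n)"
    and meas [measurable]: "\<And>n. 1 \<le> n \<Longrightarrow> \<xi> n \<in> borel_measurable M"
    and adapted: "\<And>m n. 1 \<le> m \<Longrightarrow> m < n \<Longrightarrow> \<xi> m \<in> borel_measurable (F n)"
    and filt: "\<And>m n. m \<le> n \<Longrightarrow> sets (F m) \<subseteq> sets (F n)"
    and int: "\<And>n. 1 \<le> n \<Longrightarrow> integrable M (\<lambda>x. (norm (\<xi> n x))\<^sup>2)"
    and bound: "\<And>n. 1 \<le> n \<Longrightarrow> (\<integral>x. (norm (\<xi> n x))\<^sup>2 \<partial>M) \<le> C"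
    and mart: "\<And>n W. 1 \<le> n \<Longrightarrow> W \<in> borel_measurable (F n) \<Longrightarrow> integrable M (\<lambda>x. (norm (W x))\<^sup>2) \<Longrightarrow>
        (\<integral>x. inner (\<xi> n x) (W x) \<partial>M) = 0"
    and w: "\<And>n. 1 \<le> n \<Longrightarrow> w n \<in> borel_measurable (F n)"
    and w1: "\<And>n x. 1 \<le> n \<Longrightarrow> x \<in> space M \<Longrightarrow> norm (w n x) \<le> 1"
  shows "AE x in M. (\<lambda>T. (\<Sum>n = 1..T. inner (\<xi> n x) (w n x)) / real T) \<longlonglongrightarrow> 0"
proof -
  have wM [measurable]: "w n \<in> borel_measurable M" if "1 \<le> n" for n
    using measurable_from_subalg[OF sub w[OF that]] .
  have sp: "space (F n) = space M" for n using sub by (auto simp: subalgebra_def)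
  have cs: "(inner (\<xi> n x) (w n x))\<^sup>2 \<le> (norm (\<xi> n x))\<^sup>2" if "1 \<le> n" "x \<in> space M" for n x
  proof -
    have "\<bar>inner (\<xi> n x) (w n x)\<bar> \<le> norm (\<xi> n x) * norm (w n x)" by (rule Cauchy_Schwarz_ineq2)
    also have "\<dots> \<le> norm (\<xi> n x) * 1" using w1 that by (intro mult_left_mono) auto
    finally show ?thesis by (simp add: abs_le_square_iff[symmetric])
  qed
  show ?thesis
  proof (rule AE_average_orthogonal_tendsto_0)
    fix n :: nat assume n: "1 \<le> n"
    show ms [measurable]: "(\<lambda>x. inner (\<xi> n x) (w n x)) \<in> borel_measurable M" using n by simp
    show i: "integrable M (\<lambda>x. (inner (\<xi> n x) (w n x))\<^sup>2)"
      by (rule Bochner_Integration.integrable_bound[OF int[OF n]]) (use cs n in auto)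
    have "(\<integral>x. (inner (\<xi> n x) (w n x))\<^sup>2 \<partial>M) \<le> (\<integral>x. (norm (\<xi> n x))\<^sup>2 \<partial>M)"
      by (intro integral_mono i int n cs) auto
    then show "(\<integral>x. (inner (\<xi> n x) (w n x))\<^sup>2 \<partial>M) \<le> C" using bound[OF n] by simp
  next
    fix m n :: nat assume m: "1 \<le> m" and mn: "m < n"
    then have n: "1 \<le> n" by simp
    have wF: "w m \<in> borel_measurable (F n)"
      using w[OF m] filt[of m n] mn by (auto simp: measurable_def sp)
    \<comment> \<open>The earlier scalar times \<open>w n\<close> is known at stage
      \<open>n\<close>, so it may serve as the test vector \<open>W\<close> in \<open>mart\<close>;
      the result is the cross moment.\<close>
    have "(\<integral>x. inner (\<xi> n x) (inner (\<xi> m x) (w m x) *\<^sub>R w n x) \<partial>M) = 0"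
    proof (rule mart[OF n])
      show "(\<lambda>x. inner (\<xi> m x) (w m x) *\<^sub>R w n x) \<in> borel_measurable (F n)"
        using adapted[OF m mn] wF w[OF n] by measurable
      show "integrable M (\<lambda>x. (norm (inner (\<xi> m x) (w m x) *\<^sub>R w n x))\<^sup>2)"
      proof (rule Bochner_Integration.integrable_bound[OF int[OF m]])
        have "(norm (inner (\<xi> m x) (w m x) *\<^sub>R w n x))\<^sup>2 \<le> (norm (\<xi> m x))\<^sup>2" if "x \<in> space M" for x
        proof -
          have "(norm (inner (\<xi> m x) (w m x) *\<^sub>R w n x))\<^sup>2 = (inner (\<xi> m x) (w m x))\<^sup>2 * (norm (w n x))\<^sup>2"
            by (simp add: power_mult_distrib)
          also have "\<dots> \<le> (norm (\<xi> m x))\<^sup>2 * 1"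
            using cs[OF m that] w1[OF n that] by (intro mult_mono) (auto simp: power_le_one)
          finally show ?thesis by simp
        qed
        then show "AE x in M. norm ((norm (inner (\<xi> m x) (w m x) *\<^sub>R w n x))\<^sup>2) \<le> norm ((norm (\<xi> m x))\<^sup>2)"
          by auto
      qed (use m n in measurable)
    qed
    then show "(\<integral>x. inner (\<xi> m x) (w m x) * inner (\<xi> n x) (w n x) \<partial>M) = 0" by simp
  qed
qed

section \<open>Projected online gradient ascent\<close>

text \<open>Expanding the square after one step and dividing by \<open>g n\<close> leaves
  differences of half squared distances weighted by \<open>1 / g n\<close>. These weights increase
  and the distances \<open>D n\<close> are at most 1, so summation by parts costs only
  \<open>1 / g T\<close>.\<close>

lemma online_gradient_bound:
  fixes x v :: "nat \<Rightarrow> 'a::real_inner"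
  assumes step: "\<And>n. 1 \<le> n \<Longrightarrow> norm (x (Suc n) - z) \<le> norm (x n + g n *\<^sub>R v n - z)"
    and diam: "\<And>n. 1 \<le> n \<Longrightarrow> (norm (x n - z))\<^sup>2 \<le> 2"
    and g: "\<And>n. 1 \<le> n \<Longrightarrow> 0 < g n" and dec: "\<And>n. 1 \<le> n \<Longrightarrow> g (Suc n) \<le> g n"
    and T: "1 \<le> T"
  shows "(\<Sum>n = 1..T. inner (v n) (z - x n)) \<le> 1 / g T + (\<Sum>n = 1..T. g n / 2 * (norm (v n))\<^sup>2)"
proof -
  define D where "D n = (norm (x n - z))\<^sup>2 / 2" for n
  have D1: "D n \<le> 1" if "1 \<le> n" for n using diam[OF that] by (simp add: D_def)
  have one: "inner (v n) (z - x n) \<le> (D n - D (Suc n)) / g n + g n / 2 * (norm (v n))\<^sup>2" if n: "1 \<le> n" for n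
  proof -
    have "(norm (x (Suc n) - z))\<^sup>2 \<le> (norm ((x n - z) + g n *\<^sub>R v n))\<^sup>2"
      using step[OF n] by (intro power_mono) (simp_all add: algebra_simps)
    also have "\<dots> = (norm (x n - z))\<^sup>2 - 2 * g n * inner (v n) (z - x n) + (g n)\<^sup>2 * (norm (v n))\<^sup>2"
      unfolding power2_norm_eq_inner by (simp add: algebra_simps inner_commute power2_eq_square)
    finally have "g n * inner (v n) (z - x n) \<le> D n - D (Suc n) + (g n)\<^sup>2 * (norm (v n))\<^sup>2 / 2"
      by (simp add: D_def)
    then have "inner (v n) (z - x n) \<le> (D n - D (Suc n) + (g n)\<^sup>2 * (norm (v n))\<^sup>2 / 2) / g n"
      using g[OF n] by (simp add: field_simps)
    also have "\<dots> = (D n - D (Suc n)) / g n + g n / 2 * (norm (v n))\<^sup>2"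
      using g[OF n] by (simp add: add_divide_distrib power2_eq_square)
    finally show ?thesis .
  qed
  \<comment> \<open>The induction must keep \<open>- D (Suc T) / g T\<close>: it cancels against the
    next difference, and \<open>1 - D (Suc T) \<ge> 0\<close> pays for the change of weight.\<close>
  have "(\<Sum>n = 1..T. inner (v n) (z - x n)) \<le> (1 - D (Suc T)) / g T + (\<Sum>n = 1..T. g n / 2 * (norm (v n))\<^sup>2)"
    using T
  proof (induction T rule: nat_induct_at_least)
    case base
    have "(D 1 - D (Suc 1)) / g 1 \<le> (1 - D (Suc 1)) / g 1"
      using D1[of 1] g[of 1] by (intro divide_right_mono) auto
    then show ?case using one[of 1] by simp
  next
    case (Suc T)
    have "(1 - D (Suc T)) / g T \<le> (1 - D (Suc T)) / g (Suc T)"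
      using Suc.hyps D1[of "Suc T"] g[of "Suc T"] dec[of T] by (intro divide_left_mono) auto
    then have "(1 - D (Suc T)) / g T + (D (Suc T) - D (Suc (Suc T))) / g (Suc T) \<le> (1 - D (Suc (Suc T))) / g (Suc T)"
      by (simp add: diff_divide_distrib)
    then show ?case using Suc.IH one[of "Suc T"] by simp
  qed
  also have "(1 - D (Suc T)) / g T \<le> 1 / g T"
    using g[OF T] by (intro divide_right_mono) (auto simp: D_def)
  finally show ?thesis by simp
qed

section \<open>Testing the conditional mean against predictable matrices\<close>

lemma integral_mult_cond_exp:
  assumes "sigma_finite_subalgebra M F" and f: "f \<in> borel_measurable F"
    and g: "g \<in> borel_measurable M" and v: "v \<in> borel_measurable M"
    and i: "integrable M (\<lambda>x. f x * g x)"
    and ae: "AE x in M. real_cond_exp M F g x = v x"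
  shows "integrable M (\<lambda>x. f x * v x)" "(\<integral>x. f x * v x \<partial>M) = (\<integral>x. f x * g x \<partial>M)"
proof -
  interpret sigma_finite_subalgebra M F by fact
  note * = real_cond_exp_intg[OF i f g]
  have [measurable]: "f \<in> borel_measurable M" by (rule measurable_from_subalg[OF subalg f])
  note [measurable] = v
  have ae': "AE x in M. f x * real_cond_exp M F g x = f x * v x" using ae by eventually_elim simp
  show "integrable M (\<lambda>x. f x * v x)"
    using *(1) ae' by (subst integrable_cong_AE[symmetric]) auto
  show "(\<integral>x. f x * v x \<partial>M) = (\<integral>x. f x * g x \<partial>M)"
    using *(2) ae' by (subst integral_cong_AE[of _ _ "\<lambda>x. f x * real_cond_exp M F g x"]) auto
qed

lemma borel_measurable_matrix_entry:
  fixes W :: "'w \<Rightarrow> complex^'n^'m"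
  assumes "W \<in> borel_measurable M"
  shows "(\<lambda>x. Re (W x $ i $ j)) \<in> borel_measurable M" "(\<lambda>x. Im (W x $ i $ j)) \<in> borel_measurable M"
  by (rule measurable_compose[OF assms], rule borel_measurable_continuous_onI, intro continuous_intros)+

lemma integrable_matrix_entry_square:
  fixes W :: "'w \<Rightarrow> complex^'n^'m"
  assumes [measurable]: "W \<in> borel_measurable M" and i: "integrable M (\<lambda>x. (norm (W x))\<^sup>2)"
  shows "integrable M (\<lambda>x. (Re (W x $ i $ j))\<^sup>2)" "integrable M (\<lambda>x. (Im (W x $ i $ j))\<^sup>2)"
proof -
  have "\<bar>Re (A $ i $ j)\<bar> \<le> norm A" "\<bar>Im (A $ i $ j)\<bar> \<le> norm A" for A :: "complex^'n^'m"
    by (meson abs_Re_le_cmod abs_Im_le_cmod Finite_Cartesian_Product.norm_nth_le order_trans)+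
  then have le: "(Re (A $ i $ j))\<^sup>2 \<le> (norm A)\<^sup>2" "(Im (A $ i $ j))\<^sup>2 \<le> (norm A)\<^sup>2" for A :: "complex^'n^'m"
    by (simp_all add: abs_le_square_iff[symmetric])
  note [measurable] = borel_measurable_matrix_entry[OF assms(1)]
  show "integrable M (\<lambda>x. (Re (W x $ i $ j))\<^sup>2)" "integrable M (\<lambda>x. (Im (W x $ i $ j))\<^sup>2)"
    by (rule Bochner_Integration.integrable_bound[OF i]; use le in simp)+
qed

text \<open>Unbiasedness is known entrywise for real and imaginary parts, and the real inner product
  splits into exactly these. Square integrability of \<open>g\<close> and \<open>W\<close> makes
  their products integrable; conditioning passes this on to the products with
  \<open>v\<close>.\<close>

lemma integral_inner_cond_exp:
  fixes g v W :: "'w \<Rightarrow> complex^'n^'m"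
  assumes sub: "sigma_finite_subalgebra M F"
    and g: "g \<in> borel_measurable M" "integrable M (\<lambda>x. (norm (g x))\<^sup>2)"
    and v: "v \<in> borel_measurable M"
    and W: "W \<in> borel_measurable F" "integrable M (\<lambda>x. (norm (W x))\<^sup>2)"
    and ae: "\<And>i j. AE x in M. real_cond_exp M F (\<lambda>x. Re (g x $ i $ j)) x = Re (v x $ i $ j)"
      "\<And>i j. AE x in M. real_cond_exp M F (\<lambda>x. Im (g x $ i $ j)) x = Im (v x $ i $ j)"
  shows "(\<integral>x. inner (v x - g x) (W x) \<partial>M) = 0"
proof -
  have subalg: "subalgebra M F" using sub by (simp add: sigma_finite_subalgebra_def)
  have WM: "W \<in> borel_measurable M" by (rule measurable_from_subalg[OF subalg W(1)])
  note m = borel_measurable_matrix_entry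
  note s = integrable_matrix_entry_square
  have ir: "integrable M (\<lambda>x. Re (W x $ i $ j) * Re (g x $ i $ j))"
    and ii: "integrable M (\<lambda>x. Im (W x $ i $ j) * Im (g x $ i $ j))" for i j
    by (intro integrable_prod_of_square m s g W WM)+
  note re = integral_mult_cond_exp[OF sub m(1)[OF W(1)] m(1)[OF g(1)] m(1)[OF v] ir ae(1)]
  note im = integral_mult_cond_exp[OF sub m(2)[OF W(1)] m(2)[OF g(1)] m(2)[OF v] ii ae(2)]
  have eq: "inner (v x - g x) (W x) = (\<Sum>i\<in>UNIV. \<Sum>j\<in>UNIV.
      (Re (W x $ i $ j) * Re (v x $ i $ j) - Re (W x $ i $ j) * Re (g x $ i $ j)) +
      (Im (W x $ i $ j) * Im (v x $ i $ j) - Im (W x $ i $ j) * Im (g x $ i $ j)))" for x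
    by (simp add: inner_vec_def inner_complex_def algebra_simps)
  show ?thesis unfolding eq
    by (simp add: re im ir ii Bochner_Integration.integral_sum)
qed

section \<open>Regret as a real supremum over inputs\<close>

lemma bdd_above_sum_EE:
  fixes H :: "nat \<Rightarrow> complex^('k::finite \<times> 'm::finite)^('k \<times> 'n::finite)"
  assumes "Pc > 0" "Pmax > 0"
  shows "bdd_above ((\<lambda>Q. \<Sum>n = 1..T. EE Pc (H n) Q) ` QSet Pmax)"
proof -
  \<comment> \<open>Through \<open>Qmap_surj\<close> the values on \<open>QSet\<close> are values of
    a continuous function on the compact \<open>XSet\<close>; boundedness is what makes
    \<open>SUP\<close> a genuine supremum.\<close>
  have "bounded ((\<lambda>X. \<Sum>n = 1..T. EE Pc (H n) (Qmap Pc Pmax X)) ` XSet)"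
    by (intro compact_imp_bounded compact_continuous_image compact_XSet continuous_on_sum
       continuous_on_EE_Qmap assms)
  moreover have "(\<lambda>Q. \<Sum>n = 1..T. EE Pc (H n) Q) ` QSet Pmax \<subseteq>
      (\<lambda>X. \<Sum>n = 1..T. EE Pc (H n) (Qmap Pc Pmax X)) ` XSet"
  proof (rule image_subsetI)
    fix Q :: "complex^('k \<times> 'm)^('k \<times> 'm)"
    assume "Q \<in> QSet Pmax"
    then obtain X where "X \<in> XSet" "Qmap Pc Pmax X = Q" by (rule Qmap_surj[OF assms])
    then show "(\<Sum>n = 1..T. EE Pc (H n) Q) \<in> (\<lambda>X. \<Sum>n = 1..T. EE Pc (H n) (Qmap Pc Pmax X)) ` XSet"
      by blast
  qed
  ultimately show ?thesis by (meson bdd_above_mono bounded_imp_bdd_above)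
qed

lemma zero_in_QSet: "0 \<le> Pmax \<Longrightarrow> 0 \<in> QSet Pmax"
  using zero_in_XSet by (auto simp: XSet_def QSet_def trace_def)

text \<open>The comparator value involves no iterate, so all randomness of the regret sits in a
  finite subtracted sum, which settles measurability and integrability.\<close>

lemma regret_eq:
  assumes "Pc > 0" "Pmax > 0"
  shows "regret Pc Pmax H Qs T =
    (SUP Q\<in>QSet Pmax. \<Sum>n = 1..T. EE Pc (H n) Q) - (\<Sum>n = 1..T. EE Pc (H n) (Qs n))"
proof (rule antisym)
  let ?f = "\<lambda>Q. \<Sum>n = 1..T. EE Pc (H n) Q" and ?c = "\<Sum>n = 1..T. EE Pc (H n) (Qs n)"
  have ne: "QSet Pmax \<noteq> {}" using zero_in_QSet[of Pmax] assms by auto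
  note bdd = bdd_above_sum_EE[OF assms, of H T]
  have r: "regret Pc Pmax H Qs T = (SUP Q\<in>QSet Pmax. ?f Q - ?c)"
    by (simp add: regret_def sum_subtractf)
  have le: "?f Q - ?c \<le> (SUP Q\<in>QSet Pmax. ?f Q) - ?c" if "Q \<in> QSet Pmax" for Q
    using cSUP_upper[OF that bdd] by simp
  then show "regret Pc Pmax H Qs T \<le> (SUP Q\<in>QSet Pmax. ?f Q) - ?c"
    unfolding r by (intro cSUP_least ne)
  have bdd': "bdd_above ((\<lambda>Q. ?f Q - ?c) ` QSet Pmax)"
    using le by (intro bdd_aboveI2)
  have "(SUP Q\<in>QSet Pmax. ?f Q) \<le> (SUP Q\<in>QSet Pmax. ?f Q - ?c) + ?c"
    using cSUP_upper[OF _ bdd'] by (intro cSUP_least ne) (simp add: diff_le_eq)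
  then show "(SUP Q\<in>QSet Pmax. ?f Q) - ?c \<le> regret Pc Pmax H Qs T" by (simp add: r)
qed

lemma SUP_sum_EE_le:
  fixes H :: "nat \<Rightarrow> complex^('k::finite \<times> 'm::finite)^('k \<times> 'n::finite)"
  assumes "Pc > 0" "Pmax > 0"
    and "\<And>X. X \<in> XSet \<Longrightarrow> (\<Sum>n = 1..T. EE Pc (H n) (Qmap Pc Pmax X)) \<le> c"
  shows "(SUP Q\<in>QSet Pmax. \<Sum>n = 1..T. EE Pc (H n) Q) \<le> c"
proof (rule cSUP_least)
  show "QSet Pmax \<noteq> {}" using zero_in_QSet[of Pmax] assms by auto
  fix Q :: "complex^('k \<times> 'm)^('k \<times> 'm)"
  assume "Q \<in> QSet Pmax"
  then obtain X where "X \<in> XSet" "Qmap Pc Pmax X = Q" by (rule Qmap_surj[OF assms(1,2)])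
  then show "(\<Sum>n = 1..T. EE Pc (H n) Q) \<le> c" using assms(3) by blast
qed

section \<open>Combining the pathwise bound, the noise law and the moment bounds\<close>

theorem theorem2:
  fixes Pc Pmax V0 B \<beta> \<gamma> \<alpha> :: real
    and \<Omega> :: "'w measure"
    and F :: "nat \<Rightarrow> 'w measure"
    and H :: "nat \<Rightarrow> complex^('k::finite \<times> 'm::finite)^('k \<times> 'n::finite)"
    and X Vh :: "nat \<Rightarrow> 'w \<Rightarrow> complex^('k \<times> 'm)^('k \<times> 'm)"
    and X1 :: "complex^('k \<times> 'm)^('k \<times> 'm)"
  assumes "prob_space \<Omega>"
    and "Pc > 0" and "Pmax > 0"
    and "\<forall>n\<ge>1. block_diag (H n)"
    and "\<exists>C. \<forall>n\<ge>1. norm (H n) \<le> C"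
    and "\<forall>n\<ge>1. \<forall>\<omega>\<in>space \<Omega>. norm (gradV Pc Pmax (H n) (X n \<omega>)) \<le> V0"
    and "X1 \<in> XSet"
    and "\<forall>\<omega>\<in>space \<Omega>. X 1 \<omega> = X1"
    and "\<forall>n\<ge>1. \<forall>\<omega>\<in>space \<Omega>.
           X (Suc n) \<omega> = proj (X n \<omega> + (\<gamma> / real n powr \<alpha>) *\<^sub>R Vh n \<omega>)"
    and "\<forall>n\<ge>1. Vh n \<in> borel_measurable \<Omega> \<and> (\<forall>\<omega>\<in>space \<Omega>. hermitian (Vh n \<omega>))"
    and "\<forall>n. subalgebra \<Omega> (F n)"
    and "\<forall>n m. n \<le> m \<longrightarrow> sets (F n) \<subseteq> sets (F m)"
    and "\<forall>n k. 1 \<le> k \<and> k < n \<longrightarrow> Vh k \<in> borel_measurable (F n)"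
    and "\<forall>n\<ge>1. integrable \<Omega> (Vh n)"
    and "\<forall>n\<ge>1. \<forall>i j. (AE \<omega> in \<Omega>. real_cond_exp \<Omega> (F n) (\<lambda>\<omega>. Re (Vh n \<omega> $ i $ j)) \<omega>
                                  = Re (gradV Pc Pmax (H n) (X n \<omega>) $ i $ j))
                       \<and> (AE \<omega> in \<Omega>. real_cond_exp \<Omega> (F n) (\<lambda>\<omega>. Im (Vh n \<omega> $ i $ j)) \<omega>
                                  = Im (gradV Pc Pmax (H n) (X n \<omega>) $ i $ j))"
    and "B > 0" and "\<beta> > 2"
    and "\<forall>n\<ge>1. \<forall>z>0. measure \<Omega> {\<omega>\<in>space \<Omega>. z \<le> norm (Vh n \<omega> - gradV Pc Pmax (H n) (X n \<omega>))}
                       \<le> B / z powr \<beta>"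
    and "\<gamma> > 0" and "2 / \<beta> < \<alpha>" and "\<alpha> < 1"
  shows "(AE \<omega> in \<Omega>. limsup (\<lambda>T. ereal (regret Pc Pmax H (\<lambda>n. Qmap Pc Pmax (X n \<omega>)) T / real T)) \<le> 0)
       \<and> (\<forall>T\<ge>1. integrable \<Omega> (\<lambda>\<omega>. regret Pc Pmax H (\<lambda>n. Qmap Pc Pmax (X n \<omega>)) T)
              \<and> (\<integral>\<omega>. regret Pc Pmax H (\<lambda>n. Qmap Pc Pmax (X n \<omega>)) T \<partial>\<Omega>)
                  \<le> 1 / (\<gamma> / real T powr \<alpha>)
                    + (SUP n\<in>{1..}. \<integral>\<omega>. (norm (Vh n \<omega>))\<^sup>2 \<partial>\<Omega>) / 2
                      * (\<Sum>n = 1..T. \<gamma> / real n powr \<alpha>))"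
proof -
  interpret prob_space \<Omega> by fact
  note Pc = assms(2) and Pmax = assms(3) and \<gamma>0 = assms(19)
  have \<alpha>0: "0 < \<alpha>" using assms(17,20) by (smt (verit) divide_nonneg_nonneg)
  define g where "g n = \<gamma> / real n powr \<alpha>" for n :: nat
  define V where "V n \<omega> = gradV Pc Pmax (H n) (X n \<omega>)" for n \<omega>
  define \<xi> where "\<xi> n \<omega> = V n \<omega> - Vh n \<omega>" for n \<omega>
  define u where "u n Y = EE Pc (H n) (Qmap Pc Pmax Y)" for n Y
  define R where "R T \<omega> = regret Pc Pmax H (\<lambda>n. Qmap Pc Pmax (X n \<omega>)) T" for T \<omega>
  have g0: "0 < g n" if "1 \<le> n" for n using \<gamma>0 that by (simp add: g_def)
  have gdec: "g (Suc n) \<le> g n" if "1 \<le> n" for n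
    using \<gamma>0 \<alpha>0 that by (auto simp: g_def intro!: divide_left_mono powr_mono2)
  have sub: "subalgebra \<Omega> (F n)" for n using assms(11) by blast
  have sp: "space (F n) = space \<Omega>" for n using sub[of n] by (simp add: subalgebra_def)
  have filt: "sets (F m) \<subseteq> sets (F n)" if "m \<le> n" for m n using assms(12) that by blast
  have lift: "f \<in> borel_measurable (F n)" if "f \<in> borel_measurable (F m)" "m \<le> n"
    for f :: "'w \<Rightarrow> complex^('k \<times> 'm)^('k \<times> 'm)" and m n
    using that filt[of m n] by (auto simp: measurable_def sp)
  have VhM [measurable]: "Vh n \<in> borel_measurable \<Omega>" if "1 \<le> n" for n using assms(10) that by blast
  have rec: "X (Suc n) \<omega> = proj (X n \<omega> + g n *\<^sub>R Vh n \<omega>)" if "1 \<le> n" "\<omega> \<in> space \<Omega>" for n \<omega>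
    using assms(9) that by (simp add: g_def)
  have XX: "X n \<omega> \<in> XSet" if n: "1 \<le> n" and \<omega>: "\<omega> \<in> space \<Omega>" for n \<omega>
  proof (cases "n = 1")
    case True
    then show ?thesis using assms(7,8) \<omega> by simp
  next
    case False
    then obtain m where "n = Suc m" "1 \<le> m" using n by (cases n) auto
    then show ?thesis using rec \<omega> by (simp add: proj_in_XSet)
  qed
  \<comment> \<open>Predictability: \<open>X n\<close> is built from the estimates before stage
    \<open>n\<close>, all of which are known in \<open>F n\<close>.\<close>
  have XF: "X n \<in> borel_measurable (F n)" if "1 \<le> n" for n
    using that
  proof (induction n rule: nat_induct_at_least)
    case base
    have "(\<lambda>\<omega>. X1) \<in> borel_measurable (F 1)" by simp
    then show ?case by (subst measurable_cong[of _ _ "\<lambda>\<omega>. X1"]) (use assms(8) in \<open>auto simp: sp\<close>)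
  next
    case (Suc n)
    have [measurable]: "X n \<in> borel_measurable (F (Suc n))" using lift[OF Suc.IH] by simp
    have [measurable]: "Vh n \<in> borel_measurable (F (Suc n))" using assms(13) Suc.hyps by simp
    have [measurable]: "proj \<in> borel_measurable borel"
      by (intro borel_measurable_continuous_onI continuous_on_proj)
    have "(\<lambda>\<omega>. proj (X n \<omega> + g n *\<^sub>R Vh n \<omega>)) \<in> borel_measurable (F (Suc n))" by measurable
    then show ?case
      by (subst measurable_cong[of _ _ "\<lambda>\<omega>. proj (X n \<omega> + g n *\<^sub>R Vh n \<omega>)"]) (use rec Suc.hyps in \<open>auto simp: sp\<close>)
  qed
  have XM [measurable]: "X n \<in> borel_measurable \<Omega>" if "1 \<le> n" for n
    by (rule measurable_from_subalg[OF sub XF[OF that]])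
  \<comment> \<open>Utility and gradient are known to be continuous only on \<open>XSet\<close>, so
    the composition runs through the restricted Borel space.\<close>
  have cont_comp: "(\<lambda>\<omega>. f (X n \<omega>)) \<in> borel_measurable (F n)" if "continuous_on XSet f" "1 \<le> n"
    for f :: "complex^('k \<times> 'm)^('k \<times> 'm) \<Rightarrow> 'c::topological_space" and n
  proof (rule measurable_compose[OF _ borel_measurable_continuous_on_restrict[OF that(1)]])
    show "X n \<in> F n \<rightarrow>\<^sub>M restrict_space borel XSet"
      using XX XF that by (intro measurable_restrict_space2) (auto simp: sp)
  qed
  have VF: "V n \<in> borel_measurable (F n)" if "1 \<le> n" for n
    using cont_comp[OF continuous_on_gradV[OF Pc Pmax] that] by (simp add: V_def[abs_def])
  have VM [measurable]: "V n \<in> borel_measurable \<Omega>" if "1 \<le> n" for n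
    by (rule measurable_from_subalg[OF sub VF[OF that]])
  have \<xi>M [measurable]: "\<xi> n \<in> borel_measurable \<Omega>" if "1 \<le> n" for n
    using that unfolding \<xi>_def[abs_def] by simp
  have \<xi>F: "\<xi> m \<in> borel_measurable (F n)" if "1 \<le> m" "m < n" for m n
    using lift[OF VF[OF that(1)], of n] assms(13) that unfolding \<xi>_def[abs_def]
    by (intro borel_measurable_diff) auto

  define C1 where "C1 = 1 + 4 * B / (1 - 4 * 2 powr - \<beta>)"
  have \<xi>2: "integrable \<Omega> (\<lambda>\<omega>. (norm (\<xi> n \<omega>))\<^sup>2)" "(\<integral>\<omega>. (norm (\<xi> n \<omega>))\<^sup>2 \<partial>\<Omega>) \<le> C1" if n: "1 \<le> n" for n
  proof -
    have t: "prob {\<omega> \<in> space \<Omega>. z \<le> norm (\<xi> n \<omega>)} \<le> B / z powr \<beta>" if "z > 0" for z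
      using assms(18) n that by (simp add: \<xi>_def V_def norm_minus_commute)
    show "integrable \<Omega> (\<lambda>\<omega>. (norm (\<xi> n \<omega>))\<^sup>2)" "(\<integral>\<omega>. (norm (\<xi> n \<omega>))\<^sup>2 \<partial>\<Omega>) \<le> C1"
      using n assms(16,17) second_moment_of_tail[of "\<lambda>\<omega>. norm (\<xi> n \<omega>)", OF _ _ _ _ t] by (auto simp: C1_def)
  qed
  \<comment> \<open>From \<open>Vh n \<omega> = V n \<omega> - \<xi> n \<omega>\<close> and the
    bound of a squared sum by twice the sum of squares.\<close>
  define C2 where "C2 = 2 * C1 + 2 * V0\<^sup>2"
  have Vh2: "integrable \<Omega> (\<lambda>\<omega>. (norm (Vh n \<omega>))\<^sup>2)" "(\<integral>\<omega>. (norm (Vh n \<omega>))\<^sup>2 \<partial>\<Omega>) \<le> C2" if n: "1 \<le> n" for n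
  proof -
    have le: "(norm (Vh n \<omega>))\<^sup>2 \<le> 2 * (norm (\<xi> n \<omega>))\<^sup>2 + 2 * V0\<^sup>2" if \<omega>: "\<omega> \<in> space \<Omega>" for \<omega>
    proof -
      have "norm (V n \<omega>) \<le> V0" using assms(6) n \<omega> by (simp add: V_def)
      moreover have "norm (Vh n \<omega>) \<le> norm (V n \<omega>) + norm (\<xi> n \<omega>)"
        using norm_triangle_ineq4[of "V n \<omega>" "\<xi> n \<omega>"] by (simp add: \<xi>_def)
      ultimately have "(norm (Vh n \<omega>))\<^sup>2 \<le> (norm (\<xi> n \<omega>) + V0)\<^sup>2" by (intro power_mono) auto
      also have "\<dots> \<le> 2 * (norm (\<xi> n \<omega>))\<^sup>2 + 2 * V0\<^sup>2"
        using sum_squares_bound[of "norm (\<xi> n \<omega>)" V0] by (simp add: power2_sum)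
      finally show ?thesis .
    qed
    have i: "integrable \<Omega> (\<lambda>\<omega>. 2 * (norm (\<xi> n \<omega>))\<^sup>2 + 2 * V0\<^sup>2)" using \<xi>2(1)[OF n] by simp
    show j: "integrable \<Omega> (\<lambda>\<omega>. (norm (Vh n \<omega>))\<^sup>2)"
      by (rule Bochner_Integration.integrable_bound[OF i]) (use le n in auto)
    have "(\<integral>\<omega>. (norm (Vh n \<omega>))\<^sup>2 \<partial>\<Omega>) \<le> (\<integral>\<omega>. 2 * (norm (\<xi> n \<omega>))\<^sup>2 + 2 * V0\<^sup>2 \<partial>\<Omega>)"
      by (intro integral_mono i j le)
    also have "\<dots> = 2 * (\<integral>\<omega>. (norm (\<xi> n \<omega>))\<^sup>2 \<partial>\<Omega>) + 2 * V0\<^sup>2"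
      using \<xi>2(1)[OF n] by (simp add: prob_space)
    finally show "(\<integral>\<omega>. (norm (Vh n \<omega>))\<^sup>2 \<partial>\<Omega>) \<le> C2" using \<xi>2(2)[OF n] by (simp add: C2_def)
  qed
  have mart: "(\<integral>\<omega>. inner (\<xi> n \<omega>) (W \<omega>) \<partial>\<Omega>) = 0"
    if n: "1 \<le> n" and W: "W \<in> borel_measurable (F n)" "integrable \<Omega> (\<lambda>\<omega>. (norm (W \<omega>))\<^sup>2)" for n W
    unfolding \<xi>_def
  proof (rule integral_inner_cond_exp[OF _ VhM[OF n] Vh2(1)[OF n] VM[OF n] W])
    show "sigma_finite_subalgebra \<Omega> (F n)"
      by (intro finite_measure_subalgebra_is_sigma_finite finite_measure_subalgebra.intro
        finite_measure_subalgebra_axioms.intro sub finite_measure_axioms)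
  qed (use assms(15) n in \<open>auto simp: V_def\<close>)

  \<comment> \<open>Holds for every outcome and comparator; it is used pathwise for the almost sure
    claim and integrated for the mean bound.\<close>
  have regret_le: "(\<Sum>n = 1..T. u n Y) - (\<Sum>n = 1..T. u n (X n \<omega>)) \<le>
      1 / g T + (\<Sum>n = 1..T. g n / 2 * (norm (Vh n \<omega>))\<^sup>2) + (\<Sum>n = 1..T. inner (\<xi> n \<omega>) (Y - X n \<omega>))"
    if \<omega>: "\<omega> \<in> space \<Omega>" and Y: "Y \<in> XSet" and T: "1 \<le> T" for \<omega> Y T
  proof -
    have "(\<Sum>n = 1..T. u n Y) - (\<Sum>n = 1..T. u n (X n \<omega>)) \<le> (\<Sum>n = 1..T. inner (V n \<omega>) (Y - X n \<omega>))"
      unfolding sum_subtractf[symmetric] u_def V_def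
      by (intro sum_mono EE_Qmap_tangent Pc Pmax Y XX \<omega>) auto
    also have "\<dots> = (\<Sum>n = 1..T. inner (Vh n \<omega>) (Y - X n \<omega>)) + (\<Sum>n = 1..T. inner (\<xi> n \<omega>) (Y - X n \<omega>))"
      by (simp add: \<xi>_def inner_diff_left sum_subtractf)
    also have "(\<Sum>n = 1..T. inner (Vh n \<omega>) (Y - X n \<omega>)) \<le> 1 / g T + (\<Sum>n = 1..T. g n / 2 * (norm (Vh n \<omega>))\<^sup>2)"
      using rec \<omega> norm_proj_diff_le[OF Y] XSet_dist_le[OF XX Y] g0 gdec T
      by (intro online_gradient_bound) auto
    finally show ?thesis by simp
  qed
  have R_eq: "R T \<omega> = (SUP Q\<in>QSet Pmax. \<Sum>n = 1..T. EE Pc (H n) Q) - (\<Sum>n = 1..T. u n (X n \<omega>))" for T \<omega>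
    unfolding R_def u_def by (rule regret_eq[OF Pc Pmax])

  have "AE \<omega> in \<Omega>. limsup (\<lambda>T. ereal (R T \<omega> / real T)) \<le> 0"
  proof -
    \<comment> \<open>These terms bound the means of
      \<open>g n * (norm (Vh n \<omega>))\<^sup>2 / n\<close>; summability needs \<alpha> > 0, and
      Kronecker's lemma then applies on almost every path.\<close>
    have sm: "summable (\<lambda>n. \<gamma> * C2 * real n powr (- 1 - \<alpha>))"
      using \<alpha>0 by (intro summable_mult) (simp add: summable_real_powr_iff)
    have "AE \<omega> in \<Omega>. summable (\<lambda>n. if n = 0 then 0 else g n * (norm (Vh n \<omega>))\<^sup>2 / real n)"
    proof (rule AE_summable_of_summable_integral[OF _ _ _ sm])
      fix n
      show "integrable \<Omega> (\<lambda>\<omega>. if n = 0 then 0 else g n * (norm (Vh n \<omega>))\<^sup>2 / real n)"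
        using Vh2(1)[of n] by (cases "n = 0") auto
      show "0 \<le> (if n = 0 then 0 else g n * (norm (Vh n \<omega>))\<^sup>2 / real n)" for \<omega>
        using g0[of n] by auto
      show "(\<integral>\<omega>. (if n = 0 then 0 else g n * (norm (Vh n \<omega>))\<^sup>2 / real n) \<partial>\<Omega>) \<le> \<gamma> * C2 * real n powr (- 1 - \<alpha>)"
      proof (cases "n = 0")
        case False
        then have n: "1 \<le> n" by simp
        have "(\<integral>\<omega>. g n * (norm (Vh n \<omega>))\<^sup>2 / real n \<partial>\<Omega>) = g n * (\<integral>\<omega>. (norm (Vh n \<omega>))\<^sup>2 \<partial>\<Omega>) / real n" by simp
        also have "\<dots> \<le> g n * C2 / real n"
          using g0[OF n] Vh2(2)[OF n] by (intro divide_right_mono mult_left_mono) auto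
        also have "\<dots> = \<gamma> * C2 * real n powr (- 1 - \<alpha>)"
          using n by (simp add: g_def powr_diff powr_minus field_simps)
        finally show ?thesis using False by simp
      qed simp
    qed
    \<comment> \<open>Finitely many basis directions share one null set, and together they send the
      averaged noise vector to zero in norm.\<close>
    moreover have "AE \<omega> in \<Omega>. \<forall>b\<in>Basis. (\<lambda>T. (\<Sum>n = 1..T. inner (\<xi> n \<omega>) b) / real T) \<longlonglongrightarrow> 0"
      by (intro AE_finite_allI finite_Basis AE_average_martingale_noise[of _ F _ C1] sub \<xi>M \<xi>F filt \<xi>2 mart) auto
    moreover have "AE \<omega> in \<Omega>. (\<lambda>T. (\<Sum>n = 1..T. inner (\<xi> n \<omega>) (X n \<omega>)) / real T) \<longlonglongrightarrow> 0"
      using XX by (intro AE_average_martingale_noise[of _ F _ C1] sub \<xi>M \<xi>F filt \<xi>2 mart XF XSetD(5)) auto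
    moreover have "AE \<omega> in \<Omega>. \<omega> \<in> space \<Omega>" by (rule AE_space)
    ultimately show ?thesis
    proof eventually_elim
      fix \<omega>
      assume 1: "summable (\<lambda>n. if n = 0 then 0 else g n * (norm (Vh n \<omega>))\<^sup>2 / real n)"
        and 2: "\<forall>b\<in>Basis. (\<lambda>T. (\<Sum>n = 1..T. inner (\<xi> n \<omega>) b) / real T) \<longlonglongrightarrow> 0"
        and 3: "(\<lambda>T. (\<Sum>n = 1..T. inner (\<xi> n \<omega>) (X n \<omega>)) / real T) \<longlonglongrightarrow> 0"
        and \<omega>: "\<omega> \<in> space \<Omega>"
      define a where "a n = (if n = 0 then 0 else g n * (norm (Vh n \<omega>))\<^sup>2)" for n
      have "(\<lambda>T. (\<Sum>n = 1..T. a n) / real T) \<longlonglongrightarrow> 0"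
      proof (rule kronecker_nonneg)
        show "0 \<le> a n" for n using g0[of n] by (auto simp: a_def)
        show "summable (\<lambda>n. a n / real n)" using 1 by (rule summable_cong[THEN iffD1, rotated]) (auto simp: a_def)
      qed
      then have lim1: "(\<lambda>T. (\<Sum>n = 1..T. a n) / real T / 2) \<longlonglongrightarrow> 0" by (rule tendsto_divide_zero)
      define S where "S T = (1 / real T) *\<^sub>R (\<Sum>n = 1..T. \<xi> n \<omega>)" for T
      have "S \<longlonglongrightarrow> 0"
        using 2 by (subst tendsto_componentwise_iff) (simp add: S_def inner_sum_left)
      then have lim2: "(\<lambda>T. norm (S T)) \<longlonglongrightarrow> 0" by (rule tendsto_norm_zero)
      have lim0: "(\<lambda>T. 1 / g T / real T) \<longlonglongrightarrow> 0"
        unfolding g_def using \<gamma>0 assms(21) by real_asymp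
      define b where "b T = 1 / g T / real T + (\<Sum>n = 1..T. a n) / real T / 2 + norm (S T)
          - (\<Sum>n = 1..T. inner (\<xi> n \<omega>) (X n \<omega>)) / real T" for T
      have "b \<longlonglongrightarrow> 0 + 0 + 0 - 0" unfolding b_def by (intro tendsto_intros lim0 lim1 lim2 3)
      then have lim: "(\<lambda>T. ereal (b T)) \<longlonglongrightarrow> 0" by (simp add: zero_ereal_def)
      have "R T \<omega> / real T \<le> b T" if T: "1 \<le> T" for T
      proof -
        have T0: "0 < real T" using T by simp
        \<comment> \<open>\<open>b\<close> is free of \<open>Y\<close>: as
          \<open>norm Y \<le> 1\<close>, the comparator's share of the noise is at most
          \<open>norm (S T)\<close>, uniformly.\<close>
        have "(\<Sum>n = 1..T. EE Pc (H n) (Qmap Pc Pmax Y)) \<le> real T * b T + (\<Sum>n = 1..T. u n (X n \<omega>))"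
          if Y: "Y \<in> XSet" for Y
        proof -
          have "inner (\<Sum>n = 1..T. \<xi> n \<omega>) Y = real T * inner (S T) Y" using T0 by (simp add: S_def)
          also have "\<dots> \<le> real T * (norm (S T) * 1)"
            using XSetD(5)[OF Y]
            by (intro mult_left_mono order_trans[OF norm_cauchy_schwarz]) auto
          finally have "(\<Sum>n = 1..T. inner (\<xi> n \<omega>) (Y - X n \<omega>)) \<le>
              real T * norm (S T) - (\<Sum>n = 1..T. inner (\<xi> n \<omega>) (X n \<omega>))"
            by (simp add: inner_diff_right sum_subtractf inner_sum_left)
          moreover have "(\<Sum>n = 1..T. g n / 2 * (norm (Vh n \<omega>))\<^sup>2) = (\<Sum>n = 1..T. a n) / 2"
            unfolding sum_divide_distrib by (intro sum.cong) (auto simp: a_def)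
          moreover have "real T * b T = 1 / g T + (\<Sum>n = 1..T. a n) / 2 + real T * norm (S T) -
              (\<Sum>n = 1..T. inner (\<xi> n \<omega>) (X n \<omega>))"
            using T0 by (simp add: b_def field_simps)
          ultimately show ?thesis using regret_le[OF \<omega> Y T] by (simp add: u_def)
        qed
        then have "R T \<omega> \<le> real T * b T"
          unfolding R_eq diff_le_eq by (rule SUP_sum_EE_le[OF Pc Pmax])
        then show ?thesis using T0 by (simp add: divide_le_eq mult.commute)
      qed
      then have "limsup (\<lambda>T. ereal (R T \<omega> / real T)) \<le> limsup (\<lambda>T. ereal (b T))"
        by (intro Limsup_mono eventually_sequentiallyI[of 1]) simp
      also have "\<dots> = 0" using lim by (intro lim_imp_Limsup) auto
      finally show "limsup (\<lambda>T. ereal (R T \<omega> / real T)) \<le> 0" .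
    qed
  qed
  moreover have "integrable \<Omega> (R T) \<and> (\<integral>\<omega>. R T \<omega> \<partial>\<Omega>) \<le> 1 / g T + (SUP n\<in>{1..}. \<integral>\<omega>. (norm (Vh n \<omega>))\<^sup>2 \<partial>\<Omega>) / 2 * (\<Sum>n = 1..T. g n)"
    if T: "1 \<le> T" for T
  proof -
    let ?s = "SUP n\<in>{1..}. \<integral>\<omega>. (norm (Vh n \<omega>))\<^sup>2 \<partial>\<Omega>"
    let ?U = "SUP Q\<in>QSet Pmax. \<Sum>n = 1..T. EE Pc (H n) Q"
    have iu: "integrable \<Omega> (\<lambda>\<omega>. u n (X n \<omega>))" if n: "1 \<le> n" for n
    proof -
      have c: "continuous_on XSet (u n)" unfolding u_def by (rule continuous_on_EE_Qmap[OF Pc Pmax])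
      then have "bounded (u n ` XSet)" by (intro compact_imp_bounded compact_continuous_image compact_XSet)
      then obtain b where "\<And>Y. Y \<in> XSet \<Longrightarrow> norm (u n Y) \<le> b" by (auto simp: bounded_iff)
      then show ?thesis
        using XX[OF n] by (intro integrable_const_bound[of _ b] measurable_from_subalg[OF sub cont_comp[OF c n]]) auto
    qed
    then have iU: "integrable \<Omega> (\<lambda>\<omega>. \<Sum>n = 1..T. u n (X n \<omega>))" by (intro Bochner_Integration.integrable_sum) auto
    \<comment> \<open>The uniform bound \<open>C2\<close> ensures that \<open>?s\<close> really is
      an upper bound.\<close>
    have s: "(\<integral>\<omega>. (norm (Vh n \<omega>))\<^sup>2 \<partial>\<Omega>) \<le> ?s" if "1 \<le> n" for n
      using that Vh2(2) by (intro cSUP_upper bdd_aboveI2[of _ _ C2]) auto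
    have "?U \<le> 1 / g T + ?s / 2 * (\<Sum>n = 1..T. g n) + (\<integral>\<omega>. (\<Sum>n = 1..T. u n (X n \<omega>)) \<partial>\<Omega>)"
    proof (rule SUP_sum_EE_le[OF Pc Pmax])
      fix Y :: "complex^('k \<times> 'm)^('k \<times> 'm)" assume Y: "Y \<in> XSet"
      have YX: "(\<lambda>\<omega>. Y - X n \<omega>) \<in> borel_measurable (F n)" "integrable \<Omega> (\<lambda>\<omega>. (norm (Y - X n \<omega>))\<^sup>2)"
        if n: "1 \<le> n" for n
      proof -
        show "(\<lambda>\<omega>. Y - X n \<omega>) \<in> borel_measurable (F n)" using XF[OF n] by simp
        show "integrable \<Omega> (\<lambda>\<omega>. (norm (Y - X n \<omega>))\<^sup>2)"
          using XSet_dist_le[OF Y XX[OF n]] n by (intro integrable_const_bound[of _ 2]) auto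
      qed
      have i\<xi>: "integrable \<Omega> (\<lambda>\<omega>. inner (\<xi> n \<omega>) (Y - X n \<omega>))" if n: "1 \<le> n" for n
      proof (rule Bochner_Integration.integrable_bound)
        show "integrable \<Omega> (\<lambda>\<omega>. norm (\<xi> n \<omega>) * norm (Y - X n \<omega>))"
          using n by (intro integrable_prod_of_square \<xi>2 YX) auto
        show "(\<lambda>\<omega>. inner (\<xi> n \<omega>) (Y - X n \<omega>)) \<in> borel_measurable \<Omega>" using n by simp
      qed (auto simp: Cauchy_Schwarz_ineq2)
      have iR: "integrable \<Omega> (\<lambda>\<omega>. 1 / g T + (\<Sum>n = 1..T. g n / 2 * (norm (Vh n \<omega>))\<^sup>2) + (\<Sum>n = 1..T. inner (\<xi> n \<omega>) (Y - X n \<omega>)))"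
        using Vh2(1) i\<xi> by (intro Bochner_Integration.integrable_add Bochner_Integration.integrable_sum integrable_mult_right) auto
      have "(\<Sum>n = 1..T. u n Y) - (\<integral>\<omega>. (\<Sum>n = 1..T. u n (X n \<omega>)) \<partial>\<Omega>) =
          (\<integral>\<omega>. (\<Sum>n = 1..T. u n Y) - (\<Sum>n = 1..T. u n (X n \<omega>)) \<partial>\<Omega>)"
        using iU by (simp add: prob_space)
      also have "\<dots> \<le> (\<integral>\<omega>. 1 / g T + (\<Sum>n = 1..T. g n / 2 * (norm (Vh n \<omega>))\<^sup>2) + (\<Sum>n = 1..T. inner (\<xi> n \<omega>) (Y - X n \<omega>)) \<partial>\<Omega>)"
        using iU regret_le[OF _ Y T] by (intro integral_mono iR) auto
      also have "\<dots> = 1 / g T + (\<Sum>n = 1..T. g n / 2 * (\<integral>\<omega>. (norm (Vh n \<omega>))\<^sup>2 \<partial>\<Omega>)) + (\<Sum>n = 1..T. \<integral>\<omega>. inner (\<xi> n \<omega>) (Y - X n \<omega>) \<partial>\<Omega>)"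
      proof -
        have "integrable \<Omega> (\<lambda>\<omega>. \<Sum>n = 1..T. g n / 2 * (norm (Vh n \<omega>))\<^sup>2)"
          "integrable \<Omega> (\<lambda>\<omega>. \<Sum>n = 1..T. inner (\<xi> n \<omega>) (Y - X n \<omega>))"
          using Vh2(1) i\<xi> by (intro Bochner_Integration.integrable_sum integrable_mult_right; simp)+
        moreover have "(\<integral>\<omega>. (\<Sum>n = 1..T. g n / 2 * (norm (Vh n \<omega>))\<^sup>2) \<partial>\<Omega>) = (\<Sum>n = 1..T. g n / 2 * (\<integral>\<omega>. (norm (Vh n \<omega>))\<^sup>2 \<partial>\<Omega>))"
          using Vh2(1) by (subst Bochner_Integration.integral_sum) auto
        moreover have "(\<integral>\<omega>. (\<Sum>n = 1..T. inner (\<xi> n \<omega>) (Y - X n \<omega>)) \<partial>\<Omega>) = (\<Sum>n = 1..T. \<integral>\<omega>. inner (\<xi> n \<omega>) (Y - X n \<omega>) \<partial>\<Omega>)"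
          using i\<xi> by (intro Bochner_Integration.integral_sum) auto
        ultimately show ?thesis by (simp add: prob_space)
      qed
      \<comment> \<open>With \<open>Y\<close> fixed, \<open>Y - X n \<omega>\<close> is predictable
        and bounded, hence an admissible test matrix for \<open>mart\<close>.\<close>
      also have "(\<Sum>n = 1..T. \<integral>\<omega>. inner (\<xi> n \<omega>) (Y - X n \<omega>) \<partial>\<Omega>) = 0"
        using mart[OF _ YX] by (intro sum.neutral) auto
      also have "(\<Sum>n = 1..T. g n / 2 * (\<integral>\<omega>. (norm (Vh n \<omega>))\<^sup>2 \<partial>\<Omega>)) \<le> (\<Sum>n = 1..T. g n / 2 * ?s)"
        using g0 by (intro sum_mono mult_left_mono s) (auto simp: less_imp_le)
      also have "\<dots> = ?s / 2 * (\<Sum>n = 1..T. g n)"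
        unfolding sum_distrib_left by (intro sum.cong) (simp_all add: mult.commute)
      finally show "(\<Sum>n = 1..T. EE Pc (H n) (Qmap Pc Pmax Y)) \<le>
          1 / g T + ?s / 2 * (\<Sum>n = 1..T. g n) + (\<integral>\<omega>. (\<Sum>n = 1..T. u n (X n \<omega>)) \<partial>\<Omega>)"
        by (simp add: u_def)
    qed
    moreover have "integrable \<Omega> (R T)" unfolding R_eq[abs_def] using iU by simp
    moreover have "(\<integral>\<omega>. R T \<omega> \<partial>\<Omega>) = ?U - (\<integral>\<omega>. (\<Sum>n = 1..T. u n (X n \<omega>)) \<partial>\<Omega>)"
      unfolding R_eq using iU by (simp add: prob_space)
    ultimately show ?thesis by simp
  qed
  ultimately show ?thesis unfolding R_def[abs_def] g_def by blast
qed

end
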